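(* Let $\mathcal{A}\subset\mathbb{N}=\{1,2,\dots\}$ be a non-empty subset with $1\in\mathcal{A}$, and assume that $\mathcal{A}\neq\{1,2\}$. Let $b>0$ be such that $\sum_{k+1\in\mathcal{A}}(k+1)(k-1)b^k=0$ and define $$K_{\mathcal{A}}=\gcd(\mathcal{A}-1)\cdot\sqrt{\frac{\sum_{k+1\in\mathcal{A}}(k+1)b^k}{2\pi\sum_{k+1\in\mathcal{A}}(k+1)(k^2-1)b^k}}\cdot\Big(\sum_{k\in\mathcal{A}}k\,b^k\Big).$$ Then $$\#\mathbb{NC}_n^{\mathcal{A}}\ \underset{n\to\infty}{\sim}\ K_{\mathcal{A}}\cdot\Big(\sum_{k+1\in\mathcal{A}}(k+1)b^{k-1}\Big)^{n-1}\cdot n^{-3/2},$$ where the limit is taken along the subsequence of those values of $n$ for which $\mathbb{NC}_n^{\mathcal{A}}\ne\varnothing$.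
   Context: A noncrossing tree with $n$ vertices is a tree drawn in the closed unit disk whose vertices are the $n$-th roots of unity and whose edges are straight line segments which do not cross (distinct edges may only meet at a common endpoint). $\mathbb{NC}_n^{\mathcal{A}}$ is the set of all noncrossing trees with $n$ vertices all of whose vertex degrees (graph degrees) belong to $\mathcal{A}$. Sums over "$k+1\in\mathcal{A}$" are over integers $k\ge0$ with $k+1\in\mathcal{A}$, and $\gcd(\mathcal{A}-1)$ is the greatest common divisor of $\{a-1:a\in\mathcal{A}\}$. *)

theory Defs
  imports "HOL-Analysis.Analysis" "HOL-Library.Landau_Symbols"
begin

definition connected_graph :: "'a set \<Rightarrow> 'a set set \<Rightarrow> bool" where
  "connected_graph V E \<longleftrightarrow> V \<noteq> {} \<and> (\<forall>u\<in>V. \<forall>v\<in>V. (u, v) \<in> {(x, y). {x, y} \<in> E}\<^sup>*)"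

text \<open>A cycle is given by the list of its vertices in order, without repeating the first one at
  the end; it has at least three vertices.\<close>

definition graph_cycle :: "'a set set \<Rightarrow> 'a list \<Rightarrow> bool" where
  "graph_cycle E c \<longleftrightarrow>
     length c \<ge> 3 \<and> distinct c \<and> successively (\<lambda>x y. {x, y} \<in> E) c \<and> {last c, hd c} \<in> E"

definition tree_on :: "'a set \<Rightarrow> 'a set set \<Rightarrow> bool" where
  "tree_on V E \<longleftrightarrow>
     (\<forall>e\<in>E. e \<subseteq> V \<and> card e = 2) \<and> connected_graph V E \<and> (\<nexists>c. graph_cycle E c)"

definition vertex_degree :: "'a set set \<Rightarrow> 'a \<Rightarrow> nat" where
  "vertex_degree E v = card {e \<in> E. v \<in> e}"

definition unity_roots :: "nat \<Rightarrow> complex set" where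
  "unity_roots n = {z. z ^ n = 1}"

text \<open>A noncrossing tree is identified with its set of edges, an edge being the set of its two
  endpoints. The edge \<open>{u, v}\<close> is drawn as \<open>convex hull {u, v} = closed_segment u v\<close>, which
  automatically lies in the closed unit disk.\<close>

definition noncrossing_tree :: "nat \<Rightarrow> complex set set \<Rightarrow> bool" where
  "noncrossing_tree n E \<longleftrightarrow>
     n \<ge> 1 \<and> tree_on (unity_roots n) E \<and>
     (\<forall>e\<in>E. \<forall>f\<in>E. e \<noteq> f \<longrightarrow> convex hull e \<inter> convex hull f \<subseteq> e \<inter> f)"

definition NC :: "nat \<Rightarrow> nat set \<Rightarrow> complex set set set" where
  "NC n A = {E. noncrossing_tree n E \<and> (\<forall>v\<in>unity_roots n. vertex_degree E v \<in> A)}"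

definition K_const :: "nat set \<Rightarrow> real \<Rightarrow> real" where
  "K_const A b =
     real (Gcd ((\<lambda>a. a - 1) ` A)) *
     sqrt ((\<Sum>\<^sub>\<infinity>k | k + 1 \<in> A. (real k + 1) * b ^ k) /
           (2 * pi * (\<Sum>\<^sub>\<infinity>k | k + 1 \<in> A. (real k + 1) * ((real k)\<^sup>2 - 1) * b ^ k))) *
     (\<Sum>\<^sub>\<infinity>k\<in>A. real k * b ^ k)"

text \<open>The exponent \<open>k - 1\<close> equals \<open>-1\<close> for \<open>k = 0\<close>, hence the integer power.\<close>

definition growth_const :: "nat set \<Rightarrow> real \<Rightarrow> real" where
  "growth_const A b = (\<Sum>\<^sub>\<infinity>k | k + 1 \<in> A. (real k + 1) * b powi (int k - 1))"

end

theory Submission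
  imports Defs "HOL-Probability.Probability" "HOL-Real_Asymp.Real_Asymp"
begin

text \<open>
  Root a noncrossing tree at the vertex \<open>1\<close>. A non-root vertex with \<open>k\<close> children splits them in
  \<open>k + 1\<close> ways into those to its left and those to its right, so the generating function \<open>T\<close> of the
  subtrees hanging below an edge satisfies \<open>T = X \<phi>(T)\<close> with \<open>\<phi>(t) = \<Sum>\<^bsub>k+1\<in>A\<^esub> (k + 1) t\<^sup>k\<close>, while the
  generating function of all trees is \<open>X \<psi>(T)\<close> with \<open>\<psi>(t) = \<Sum>\<^bsub>k\<in>A\<^esub> t\<^sup>k\<close>. Since \<open>\<psi>' = \<phi>\<close>, Lagrange
  inversion gives that \<open>(n - 1) #NC\<close> is the coefficient of \<open>t ^ (n - 2)\<close> in \<open>\<phi>\<^sup>n\<close>. The condition on \<open>b\<close> says that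
  the law proportional to \<open>(k + 1) b\<^sup>k\<close> on \<open>A - 1\<close> has mean one, and the asymptotics follow from the
  local limit theorem for its convolution powers.
\<close>

unbundle fps_syntax
unbundle no vec_syntax

section \<open>Trees on an interval of integers\<close>

text \<open>The exponent -3/2 has two sources: a sum of n independent copies of the critical law
  hits a point at bounded distance from its mean with probability of order n^(-1/2), and the
  division by n - 1 supplies the rest. The gcd in the constant is a lattice effect: the law lives on
  the multiples of d = gcd(A - 1), so the probability is concentrated on one point in d. The limit
  theorem is therefore applied to the law of the quotient by d, which is aperiodic.

  The equation for T has to be extracted from a definition by edge sets, connectedness, absence of
  cycles and straight segments. Once the roots of unity are numbered, a tree is a set of increasing
  pairs of integers, and cutting it at the longest edge of its leftmost vertex leaves three trees of
  the same kind on intervals. Thus no notion of child or rooted subtree is ever formalised. Absence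
  of cycles is replaced by the condition that every edge is a bridge: this speaks only of
  reachability, and it passes between a tree and its pieces by collapsing everything outside a piece
  to a single vertex.\<close>

lemma rtrancl_exit:
  assumes "(u, w) \<in> R\<^sup>*" "u \<in> X" "w \<notin> X"
  obtains x y where "(u, x) \<in> R\<^sup>*" "(x, y) \<in> R" "x \<in> X" "y \<notin> X"
  using assms by (induction rule: rtrancl_induct) blast+

text \<open>Mostly applied to a retraction \<open>h\<close> that fixes one piece of a tree and
  collapses the rest to the vertex where it is attached. Edges outside the piece then become empty
  paths, which is why the hypothesis asks for paths in \<open>S\<close> and not for edges.\<close>

lemma rtrancl_map:
  assumes "(u, w) \<in> R\<^sup>*" and "\<And>x y. (x, y) \<in> R \<Longrightarrow> (h x, h y) \<in> S\<^sup>*"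
  shows "(h u, h w) \<in> S\<^sup>*"
  using assms(1) by (induction rule: rtrancl_induct) (auto intro: rtrancl_trans assms(2))

definition adj :: "('a \<times> 'a) set \<Rightarrow> ('a \<times> 'a) set" where
  "adj P = P \<union> P\<inverse>"

definition deg :: "('a \<times> 'a) set \<Rightarrow> 'a \<Rightarrow> nat" where
  "deg P x = card {e \<in> P. fst e = x \<or> snd e = x}"

text \<open>Each edge is stored once, as the pair with the smaller end first. Absence of cycles is
  expressed by every edge being a bridge, and a crossing of chords by interleaved endpoints.\<close>

definition nctree :: "int \<Rightarrow> int \<Rightarrow> (int \<times> int) set \<Rightarrow> bool" where
  "nctree l r P \<longleftrightarrow>
     P \<subseteq> {(x, y). l \<le> x \<and> x < y \<and> y \<le> r} \<and>
     (\<forall>u\<in>{l..r}. \<forall>w\<in>{l..r}. (u, w) \<in> (adj P)\<^sup>*) \<and>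
     (\<forall>x y. (x, y) \<in> P \<longrightarrow> (x, y) \<notin> (adj (P - {(x, y)}))\<^sup>*) \<and>
     (\<forall>a b c d. (a, c) \<in> P \<longrightarrow> (b, d) \<in> P \<longrightarrow> \<not> (a < b \<and> b < c \<and> c < d))"

lemma adj_iff: "(x, y) \<in> adj P \<longleftrightarrow> (x, y) \<in> P \<or> (y, x) \<in> P"
  by (auto simp: adj_def)

lemma adj_mono: "P \<subseteq> Q \<Longrightarrow> adj P \<subseteq> adj Q"
  by (auto simp: adj_def)

lemma reach_mono: "(x, y) \<in> (adj P)\<^sup>* \<Longrightarrow> P \<subseteq> Q \<Longrightarrow> (x, y) \<in> (adj Q)\<^sup>*"
  using rtrancl_mono[OF adj_mono] by blast

lemma reach_sym: "(x, y) \<in> (adj P)\<^sup>* \<Longrightarrow> (y, x) \<in> (adj P)\<^sup>*"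
  using sym_rtrancl[of "adj P"] by (auto simp: adj_def sym_def)

lemma nctreeD:
  assumes "nctree l r P"
  shows "\<And>x y. (x, y) \<in> P \<Longrightarrow> l \<le> x \<and> x < y \<and> y \<le> r"
    and "\<And>u w. l \<le> u \<Longrightarrow> u \<le> r \<Longrightarrow> l \<le> w \<Longrightarrow> w \<le> r \<Longrightarrow> (u, w) \<in> (adj P)\<^sup>*"
    and "\<And>x y. (x, y) \<in> P \<Longrightarrow> (x, y) \<notin> (adj (P - {(x, y)}))\<^sup>*"
    and "\<And>a b c d. (a, c) \<in> P \<Longrightarrow> (b, d) \<in> P \<Longrightarrow> a < b \<Longrightarrow> b < c \<Longrightarrow> c < d \<Longrightarrow> False"
  using assms unfolding nctree_def by (blast | auto)+

lemma nctree_finite: "nctree l r P \<Longrightarrow> finite P"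
  by (rule finite_subset[of _ "{l..r} \<times> {l..r}"]) (auto simp: nctree_def)

section \<open>Splitting and gluing at the longest edge of the left end\<close>

definition pieces :: "int \<Rightarrow> int \<Rightarrow> int \<Rightarrow> int \<Rightarrow> (int \<times> int) set \<Rightarrow> (int \<times> int) set \<Rightarrow> (int \<times> int) set \<Rightarrow> bool" where
  "pieces l m v r P1 P2 P3 \<longleftrightarrow> l \<le> m \<and> m < v \<and> v \<le> r \<and>
     nctree l m P1 \<and> nctree (m + 1) v P2 \<and> nctree v r P3"

text \<open>Here \<open>v\<close> is the farthest neighbour of \<open>l\<close>. Without the edge
  \<open>(l, v)\<close> the tree has one component on \<open>l..m\<close> and one on
  \<open>m + 1..r\<close>; the latter is cut at \<open>v\<close> into the two wings
  \<open>P2\<close> and \<open>P3\<close> of a butterfly.\<close>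

definition join :: "int \<Rightarrow> int \<Rightarrow> (int \<times> int) set \<Rightarrow> (int \<times> int) set \<Rightarrow> (int \<times> int) set \<Rightarrow> (int \<times> int) set" where
  "join l v P1 P2 P3 = insert (l, v) (P1 \<union> P2 \<union> P3)"

lemma nctree_join:
  assumes "pieces l m v r P1 P2 P3"
  shows "nctree l r (join l v P1 P2 P3)"
proof -
  have ord: "l \<le> m" "m < v" "v \<le> r" and t1: "nctree l m P1" and t2: "nctree (m + 1) v P2"
    and t3: "nctree v r P3"
    using assms by (auto simp: pieces_def)
  note b1 = nctreeD(1)[OF t1] and b2 = nctreeD(1)[OF t2] and b3 = nctreeD(1)[OF t3]
  define E where "E = join l v P1 P2 P3"
  have sub: "P1 \<subseteq> E" "P2 \<subseteq> E" "P3 \<subseteq> E" "(l, v) \<in> E"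
    by (auto simp: E_def join_def)
  have E_cases: "(x, y) = (l, v) \<or> (x, y) \<in> P1 \<or> (x, y) \<in> P2 \<or> (x, y) \<in> P3" if "(x, y) \<in> E" for x y
    using that by (auto simp: E_def join_def)
  have E_bd: "x = l \<and> y = v \<or> (x, y) \<in> P1 \<and> l \<le> x \<and> x < y \<and> y \<le> m \<or>
      (x, y) \<in> P2 \<and> m < x \<and> x < y \<and> y \<le> v \<or> (x, y) \<in> P3 \<and> v \<le> x \<and> x < y \<and> y \<le> r"
    if "(x, y) \<in> E" for x y
    using E_cases[OF that] b1[of x y] b2[of x y] b3[of x y] by auto
  have 1: "E \<subseteq> {(x, y). l \<le> x \<and> x < y \<and> y \<le> r}"
  proof clarify
    fix x y assume "(x, y) \<in> E"
    from E_bd[OF this] show "l \<le> x \<and> x < y \<and> y \<le> r" using ord by (elim disjE conjE) auto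
  qed
  have to_v: "(v, u) \<in> (adj E)\<^sup>*" if "l \<le> u" "u \<le> r" for u
  proof -
    consider "u \<le> m" | "m + 1 \<le> u" "u \<le> v" | "v \<le> u" by linarith
    then show ?thesis
    proof cases
      case 1
      then have "(l, u) \<in> (adj E)\<^sup>*"
        using nctreeD(2)[OF t1, of l u] that ord reach_mono sub(1) by auto
      moreover have "(v, l) \<in> adj E" using sub(4) by (simp add: adj_iff)
      ultimately show ?thesis by (rule converse_rtrancl_into_rtrancl[rotated])
    next
      case 2
      then show ?thesis using nctreeD(2)[OF t2, of v u] ord reach_mono sub(2) by auto
    next
      case 3
      then show ?thesis using nctreeD(2)[OF t3, of v u] that ord reach_mono sub(3) by auto
    qed
  qed
  have 2: "\<forall>u\<in>{l..r}. \<forall>w\<in>{l..r}. (u, w) \<in> (adj E)\<^sup>*"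
    using to_v reach_sym rtrancl_trans by (meson atLeastAtMost_iff)
  have 3: "(x, y) \<notin> (adj (E - {(x, y)}))\<^sup>*" if "(x, y) \<in> E" for x y
  proof
    assume path: "(x, y) \<in> (adj (E - {(x, y)}))\<^sup>*"
    from E_cases[OF that] show False
    proof (elim disjE)
      \<comment> \<open>\<open>(l, v)\<close> is the only edge that leaves
        \<open>{..m}\<close>.\<close>
      assume xy: "(x, y) = (l, v)"
      obtain s t where "(s, t) \<in> adj (E - {(x, y)})" "s \<in> {..m}" "t \<notin> {..m}"
        using path by (rule rtrancl_exit[where X = "{..m}"]) (use xy ord in auto)
      then show False
        using xy E_bd[of s t] E_bd[of t s] ord unfolding adj_iff by (elim disjE) auto
    next
      assume xy: "(x, y) \<in> P1"
      \<comment> \<open>All vertices beyond \<open>m\<close> collapse to \<open>l\<close>. The ends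
        of an edge outside \<open>P1\<close> then coincide, so a detour around \<open>(x, y)\<close>
        in the whole graph projects to a detour within \<open>P1\<close>. For \<open>P2\<close> and
        \<open>P3\<close> the rest collapses to \<open>v\<close>.\<close>
      define h where "h z = (if z \<le> m then z else l)" for z
      have "(h x, h y) \<in> (adj (P1 - {(x, y)}))\<^sup>*"
      proof (rule rtrancl_map[OF path, where h = h])
        have hv: "h z = l" if "z = l \<or> m < z" for z using that by (auto simp: h_def)
        have *: "(h s, h t) \<in> (adj (P1 - {(x, y)}))\<^sup>*" if "(s, t) \<in> E" and ne: "(s, t) \<noteq> (x, y)" for s t
          using E_bd[OF that(1)]
        proof (elim disjE conjE)
          assume "(s, t) \<in> P1" "l \<le> s" "s < t" "t \<le> m"
          then show ?thesis using ne by (auto simp: h_def adj_iff intro!: r_into_rtrancl)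
        qed (use ord in \<open>simp_all add: hv\<close>)
        fix s t assume "(s, t) \<in> adj (E - {(x, y)})"
        then show "(h s, h t) \<in> (adj (P1 - {(x, y)}))\<^sup>*"
          using *[of s t] *[of t s] reach_sym by (auto simp: adj_iff)
      qed
      then show False using nctreeD(3)[OF t1 xy] b1[OF xy] by (simp add: h_def)
    next
      assume xy: "(x, y) \<in> P2"
      define h where "h z = (if m < z \<and> z \<le> v then z else v)" for z
      have "(h x, h y) \<in> (adj (P2 - {(x, y)}))\<^sup>*"
      proof (rule rtrancl_map[OF path, where h = h])
        have hv: "h z = v" if "z \<le> m \<or> v \<le> z" for z using that by (auto simp: h_def)
        have *: "(h s, h t) \<in> (adj (P2 - {(x, y)}))\<^sup>*" if "(s, t) \<in> E" and ne: "(s, t) \<noteq> (x, y)" for s t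
          using E_bd[OF that(1)]
        proof (elim disjE conjE)
          assume "(s, t) \<in> P2" "m < s" "s < t" "t \<le> v"
          then show ?thesis using ne by (auto simp: h_def adj_iff intro!: r_into_rtrancl)
        qed (use ord in \<open>simp_all add: hv\<close>)
        fix s t assume "(s, t) \<in> adj (E - {(x, y)})"
        then show "(h s, h t) \<in> (adj (P2 - {(x, y)}))\<^sup>*"
          using *[of s t] *[of t s] reach_sym by (auto simp: adj_iff)
      qed
      then show False using nctreeD(3)[OF t2 xy] b2[OF xy] by (simp add: h_def)
    next
      assume xy: "(x, y) \<in> P3"
      define h where "h z = (if v < z then z else v)" for z
      have "(h x, h y) \<in> (adj (P3 - {(x, y)}))\<^sup>*"
      proof (rule rtrancl_map[OF path, where h = h])
        have hv: "h z = v" if "z \<le> v" for z using that by (auto simp: h_def)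
        have *: "(h s, h t) \<in> (adj (P3 - {(x, y)}))\<^sup>*" if "(s, t) \<in> E" and ne: "(s, t) \<noteq> (x, y)" for s t
          using E_bd[OF that(1)]
        proof (elim disjE conjE)
          assume "(s, t) \<in> P3" "v \<le> s" "s < t" "t \<le> r"
          then show ?thesis using ne by (auto simp: h_def adj_iff intro!: r_into_rtrancl)
        qed (use ord in \<open>simp_all add: hv\<close>)
        fix s t assume "(s, t) \<in> adj (E - {(x, y)})"
        then show "(h s, h t) \<in> (adj (P3 - {(x, y)}))\<^sup>*"
          using *[of s t] *[of t s] reach_sym by (auto simp: adj_iff)
      qed
      then show False using nctreeD(3)[OF t3 xy] b3[OF xy] by (auto simp: h_def split: if_splits)
    qed
  qed
  have 4: "\<not> (a < b \<and> b < c \<and> c < d)" if "(a, c) \<in> E" "(b, d) \<in> E" for a b c d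
  proof
    assume x: "a < b \<and> b < c \<and> c < d"
    have "\<not> ((a, c) \<in> P1 \<and> (b, d) \<in> P1)" "\<not> ((a, c) \<in> P2 \<and> (b, d) \<in> P2)"
      "\<not> ((a, c) \<in> P3 \<and> (b, d) \<in> P3)"
      using nctreeD(4)[OF t1] nctreeD(4)[OF t2] nctreeD(4)[OF t3] x by blast+
    then show False
      using E_bd[OF that(1)] E_bd[OF that(2)] x ord by (elim disjE conjE) (simp | linarith)+
  qed
  show ?thesis using 1 2 3 4 unfolding E_def[symmetric] nctree_def by blast
qed

text \<open>For the farthest neighbour \<open>v\<close> of \<open>l\<close>, no edge passes over
  \<open>v\<close>: it would cross \<open>(l, v)\<close> or contradict maximality. Removing
  \<open>(l, v)\<close> leaves two components, and the absence of crossings forces the one of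
  \<open>l\<close> to be an initial interval \<open>l..m\<close>.\<close>

lemma nctree_split:
  assumes t: "nctree l r P" and "l < r"
  obtains m v P1 P2 P3 where "pieces l m v r P1 P2 P3" "P = join l v P1 P2 P3"
proof -
  note b = nctreeD(1)[OF t] and cr = nctreeD(4)[OF t]
  define Nb where "Nb = {y. (l, y) \<in> P}"
  have "finite Nb" by (rule finite_subset[of _ "{l..r}"]) (use b in \<open>force simp: Nb_def\<close>)+
  have "Nb \<noteq> {}"
  proof -
    have "(l, r) \<in> (adj P)\<^sup>*" using nctreeD(2)[OF t] \<open>l < r\<close> by auto
    then obtain x y where "(x, y) \<in> adj P" "x \<in> {l}"
      by (rule rtrancl_exit[where X = "{l}"]) (use \<open>l < r\<close> in auto)
    then show ?thesis using b[of y x] by (auto simp: Nb_def adj_iff)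
  qed
  define v where "v = Max Nb"
  have lv: "(l, v) \<in> P" using Max_in[OF \<open>finite Nb\<close> \<open>Nb \<noteq> {}\<close>] by (auto simp: v_def Nb_def)
  have v_max: "y \<le> v" if "(l, y) \<in> P" for y
    using Max_ge[OF \<open>finite Nb\<close>, of y] that by (auto simp: v_def Nb_def)
  have "l < v" "v \<le> r" using b[OF lv] by auto
  define Q where "Q = P - {(l, v)}"
  have QP: "Q \<subseteq> P" by (auto simp: Q_def)
  have lv_sep: "(l, v) \<notin> (adj Q)\<^sup>*" using nctreeD(3)[OF t lv] by (simp add: Q_def)
  have dich: "(l, u) \<in> (adj Q)\<^sup>* \<or> (v, u) \<in> (adj Q)\<^sup>*" if "l \<le> u" "u \<le> r" for u
  proof -
    have "(l, u) \<in> (adj P)\<^sup>*" using nctreeD(2)[OF t] that \<open>l < r\<close> by auto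
    then show ?thesis
    proof (induction rule: rtrancl_induct)
      case (step y z)
      show ?case
      proof (cases "(y, z) \<in> adj Q")
        case True
        then show ?thesis using step.IH by (meson rtrancl.rtrancl_into_rtrancl)
      next
        case False
        then have "z = l \<or> z = v" using step.hyps by (auto simp: adj_iff Q_def)
        then show ?thesis by auto
      qed
    qed auto
  qed
  have excl: "\<not> ((l, u) \<in> (adj Q)\<^sup>* \<and> (v, u) \<in> (adj Q)\<^sup>*)" for u
    using lv_sep reach_sym rtrancl_trans by metis
  have no_over: "\<not> (x < v \<and> v < y)" if "(x, y) \<in> P" for x y
    using b[OF that] cr[OF lv that] v_max[of y] that by (cases "x = l") auto
  define C where "C = {u. l \<le> u \<and> u \<le> r \<and> (l, u) \<in> (adj Q)\<^sup>*}"
  \<comment> \<open>A path from \<open>l\<close> to \<open>v\<close> or beyond would have to reach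
    \<open>v\<close> itself or use an edge passing over it.\<close>
  have C_less: "u < v" if "u \<in> C" for u
  proof (rule ccontr)
    assume "\<not> u < v"
    have "(l, u) \<in> (adj Q)\<^sup>*" using that by (simp add: C_def)
    then obtain x y where xy: "(l, x) \<in> (adj Q)\<^sup>*" "(x, y) \<in> adj Q" "x \<in> {..<v}" "y \<notin> {..<v}"
      by (rule rtrancl_exit[where X = "{..<v}"]) (use \<open>l < v\<close> \<open>\<not> u < v\<close> in auto)
    then have "(l, y) \<in> (adj Q)\<^sup>*" by (meson rtrancl.rtrancl_into_rtrancl)
    then have "y \<noteq> v" using lv_sep by auto
    then have "x < v \<and> v < y" using xy by auto
    moreover have "(x, y) \<in> P"
      using xy(2) b[of y x] calculation by (auto simp: adj_iff Q_def)
    ultimately show False using no_over by blast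
  qed
  have "finite C" by (rule finite_subset[of _ "{l..r}"]) (auto simp: C_def)
  have "l \<in> C" using \<open>l < r\<close> by (auto simp: C_def)
  define m where "m = Max C"
  have "m \<in> C" using Max_in[OF \<open>finite C\<close>] \<open>l \<in> C\<close> by (auto simp: m_def)
  have m_max: "u \<le> m" if "u \<in> C" for u using Max_ge[OF \<open>finite C\<close> that] by (simp add: m_def)
  have "l \<le> m" "m < v" using m_max[OF \<open>l \<in> C\<close>] C_less[OF \<open>m \<in> C\<close>] by auto
  have lm: "(l, m) \<in> (adj Q)\<^sup>*" using \<open>m \<in> C\<close> by (simp add: C_def)
  \<comment> \<open>If the component of \<open>l\<close> were not an interval, some edge in the component of \<open>v\<close> would
    separate \<open>l\<close> from \<open>m\<close>, and a path from \<open>l\<close> to \<open>m\<close> would cross it.\<close>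
  have C_interval: "x \<in> C" if lx: "l \<le> x" and xm: "x \<le> m" for x
  proof (rule ccontr)
    assume "x \<notin> C"
    have "x \<le> r" using that \<open>m < v\<close> \<open>v \<le> r\<close> by auto
    then have "(v, x) \<in> (adj Q)\<^sup>*" using dich[of x] \<open>x \<notin> C\<close> that by (auto simp: C_def)
    then obtain y a where ya: "(v, y) \<in> (adj Q)\<^sup>*" "(y, a) \<in> adj Q" "y \<in> {m<..}" "a \<notin> {m<..}"
      by (rule rtrancl_exit[where X = "{m<..}"]) (use xm \<open>m < v\<close> in auto)
    then have va: "(v, a) \<in> (adj Q)\<^sup>*" by (meson rtrancl.rtrancl_into_rtrancl)
    then have "a \<noteq> m" "a \<noteq> l" using excl[of a] lm by auto
    then have "a < m" "m < y" using ya by auto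
    then have ay: "(a, y) \<in> P" using ya(2) b[of y a] by (auto simp: adj_iff Q_def)
    then have "l < a" using b[OF ay] \<open>a \<noteq> l\<close> by auto
    obtain c d where cd: "(l, c) \<in> (adj Q)\<^sup>*" "(c, d) \<in> adj Q" "c \<in> - {a<..<y}" "d \<notin> - {a<..<y}"
      using lm by (rule rtrancl_exit[where X = "- {a<..<y}"]) (use \<open>l < a\<close> \<open>a < m\<close> \<open>m < y\<close> in auto)
    have "c \<noteq> a" "c \<noteq> y" using cd(1) va ya(1) excl by blast+
    then consider "c < a" "a < d" "d < y" | "a < d" "d < y" "y < c" using cd(3,4) by force
    then show False
    proof cases
      case 1
      then have "(c, d) \<in> P" using cd(2) b[of d c] by (auto simp: adj_iff Q_def)
      then show False using cr[OF _ ay, of c d] 1 by auto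
    next
      case 2
      then have "(d, c) \<in> P" using cd(2) b[of c d] by (auto simp: adj_iff Q_def)
      then show False using cr[OF ay, of d c] 2 by auto
    qed
  qed
  have Q_sep: "y \<le> m \<or> m < x" if "(x, y) \<in> Q" for x y
  proof (rule ccontr)
    assume *: "\<not> (y \<le> m \<or> m < x)"
    have "l \<le> x" using that b[of x y] QP by auto
    then have "(l, x) \<in> (adj Q)\<^sup>*" using C_interval[of x] * by (auto simp: C_def)
    then have "(l, y) \<in> (adj Q)\<^sup>*" using that by (meson adj_iff rtrancl.rtrancl_into_rtrancl)
    then have "y \<in> C" using b[of x y] that QP by (auto simp: C_def)
    then show False using m_max * by auto
  qed
  define P1 where "P1 = {e \<in> Q. snd e \<le> m}"
  define P2 where "P2 = {e \<in> Q. m < fst e \<and> snd e \<le> v}"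
  define P3 where "P3 = {e \<in> Q. v \<le> fst e}"
  have sub: "P1 \<subseteq> Q" "P2 \<subseteq> Q" "P3 \<subseteq> Q" by (auto simp: P1_def P2_def P3_def)
  have Q_cases: "(x, y) \<in> P1 \<or> (x, y) \<in> P2 \<or> (x, y) \<in> P3" if "(x, y) \<in> Q" for x y
    using Q_sep[OF that] no_over[of x y] that QP by (fastforce simp: P1_def P2_def P3_def)
  have b1: "l \<le> x \<and> x < y \<and> y \<le> m" if "(x, y) \<in> P1" for x y
    using that b[of x y] QP by (auto simp: P1_def)
  have b2: "m < x \<and> x < y \<and> y \<le> v" if "(x, y) \<in> P2" for x y
    using that b[of x y] QP by (auto simp: P2_def)
  have b3: "v \<le> x \<and> x < y \<and> y \<le> r" if "(x, y) \<in> P3" for x y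
    using that b[of x y] QP by (auto simp: P3_def)
  have forest: "(x, y) \<notin> (adj (S - {(x, y)}))\<^sup>*" if "(x, y) \<in> S" "S \<subseteq> P" for x y S
    using nctreeD(3)[OF t, of x y] reach_mono[of x y "S - {(x, y)}" "P - {(x, y)}"] that by blast
  have piece: "nctree l' r' S"
    if S: "S \<subseteq> Q" "\<And>x y. (x, y) \<in> S \<Longrightarrow> l' \<le> x \<and> x < y \<and> y \<le> r'"
      and z: "\<And>u. l' \<le> u \<Longrightarrow> u \<le> r' \<Longrightarrow> (z, u) \<in> (adj S)\<^sup>*" for l' r' S z
  proof -
    have "(u, w) \<in> (adj S)\<^sup>*" if "u \<in> {l'..r'}" "w \<in> {l'..r'}" for u w
      using z[of u] z[of w] that reach_sym[of z u S] rtrancl_trans[of u z "adj S" w] by auto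
    moreover have "\<not> (a < b \<and> b < c \<and> c < d)" if "(a, c) \<in> S" "(b, d) \<in> S" for a b c d
      using cr[of a c b d] that S QP by blast
    ultimately show ?thesis
      using S forest[of _ _ S] QP unfolding nctree_def by blast
  qed
  have n1: "nctree l m P1"
  proof (rule piece[where z = l])
    fix u assume u: "l \<le> u" "u \<le> m"
    \<comment> \<open>The retraction used for gluing now proves connectedness: a path of
      \<open>Q\<close> from \<open>l\<close> to \<open>u\<close> is pushed into \<open>P1\<close> by
      collapsing the other pieces to \<open>l\<close>.\<close>
    define h where "h z = (if z \<le> m then z else l)" for z
    have *: "(h s, h t) \<in> (adj P1)\<^sup>*" if "(s, t) \<in> Q" for s t
      using Q_cases[OF that] b1[of s t] b2[of s t] b3[of s t] \<open>m < v\<close>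
      by (auto simp: h_def adj_iff intro!: r_into_rtrancl)
    have "(l, u) \<in> (adj Q)\<^sup>*" using C_interval[OF u] by (simp add: C_def)
    then have "(h l, h u) \<in> (adj P1)\<^sup>*"
      by (rule rtrancl_map[where h = h]) (use * reach_sym[OF *] in \<open>auto simp: adj_iff\<close>)
    then show "(l, u) \<in> (adj P1)\<^sup>*" using u \<open>l \<le> m\<close> by (simp add: h_def)
  qed (use sub b1 in auto)
  have vQ: "(v, u) \<in> (adj Q)\<^sup>*" if "m < u" "u \<le> r" for u
    using dich[of u] m_max[of u] that \<open>l \<le> m\<close> by (force simp: C_def)
  have n2: "nctree (m + 1) v P2"
  proof (rule piece[where z = v])
    fix u assume u: "m + 1 \<le> u" "u \<le> v"
    define h where "h z = (if m < z \<and> z \<le> v then z else v)" for z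
    have hv: "h z = v" if "z \<le> m \<or> v \<le> z" for z using that by (auto simp: h_def)
    have *: "(h s, h t) \<in> (adj P2)\<^sup>*" if st: "(s, t) \<in> Q" for s t
    proof -
      consider "(s, t) \<in> P2" | "s \<le> m \<or> v \<le> s" "t \<le> m \<or> v \<le> t"
        using Q_cases[OF st] b1[of s t] b3[of s t] by fastforce
      then show ?thesis
      proof cases
        case 1
        then show ?thesis using b2[OF 1] by (auto simp: h_def adj_iff intro!: r_into_rtrancl)
      qed (simp add: hv)
    qed
    have "(v, u) \<in> (adj Q)\<^sup>*" using vQ[of u] u \<open>v \<le> r\<close> by simp
    then have "(h v, h u) \<in> (adj P2)\<^sup>*"
      by (rule rtrancl_map[where h = h]) (use * reach_sym[OF *] in \<open>auto simp: adj_iff\<close>)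
    then show "(v, u) \<in> (adj P2)\<^sup>*" using u \<open>m < v\<close> by (simp add: h_def)
  qed (use sub b2 in force)+
  have n3: "nctree v r P3"
  proof (rule piece[where z = v])
    fix u assume u: "v \<le> u" "u \<le> r"
    define h where "h z = (if v \<le> z then z else v)" for z
    have hv: "h z = v" if "z \<le> v" for z using that by (auto simp: h_def)
    have *: "(h s, h t) \<in> (adj P3)\<^sup>*" if st: "(s, t) \<in> Q" for s t
    proof -
      consider "(s, t) \<in> P3" | "s \<le> v" "t \<le> v"
        using Q_cases[OF st] b1[of s t] b2[of s t] \<open>m < v\<close> by fastforce
      then show ?thesis
      proof cases
        case 1
        then show ?thesis using b3[OF 1] by (auto simp: h_def adj_iff intro!: r_into_rtrancl)
      qed (simp add: hv)
    qed
    have "(v, u) \<in> (adj Q)\<^sup>*" using vQ[of u] u \<open>m < v\<close> by simp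
    then have "(h v, h u) \<in> (adj P3)\<^sup>*"
      by (rule rtrancl_map[where h = h]) (use * reach_sym[OF *] in \<open>auto simp: adj_iff\<close>)
    then show "(v, u) \<in> (adj P3)\<^sup>*" using u by (simp add: h_def)
  qed (use sub b3 in auto)
  have "P = join l v P1 P2 P3"
    using Q_cases sub QP lv by (auto simp: join_def Q_def)
  then show ?thesis
    using that[of m v P1 P2 P3] n1 n2 n3 \<open>l \<le> m\<close> \<open>m < v\<close> \<open>v \<le> r\<close> by (simp add: pieces_def)
qed

text \<open>The glued tree determines its data: \<open>v\<close> is the farthest neighbour of
  \<open>l\<close>, the gap between \<open>m\<close> and \<open>m + 1\<close> is the only one below
  \<open>v\<close> spanned by \<open>(l, v)\<close> alone, and the pieces are told apart by the
  positions of their edges.\<close>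

lemma join_inject:
  assumes p: "pieces l m v r P1 P2 P3" and q: "pieces l m' v' r Q1 Q2 Q3"
    and eq: "join l v P1 P2 P3 = join l v' Q1 Q2 Q3"
  shows "m = m' \<and> v = v' \<and> P1 = Q1 \<and> P2 = Q2 \<and> P3 = Q3"
proof -
  have v_le: "v2 \<le> v1" if p1: "pieces l m1 v1 r A1 A2 A3"
    and "join l v1 A1 A2 A3 = join l v2 B1 B2 B3" for m1 v1 v2 A1 A2 A3 B1 B2 B3
  proof -
    have "(l, v2) \<in> join l v1 A1 A2 A3" using that(2) by (auto simp: join_def)
    then show ?thesis
      using p1 nctreeD(1)[of l m1 A1 l v2] nctreeD(1)[of "m1 + 1" v1 A2 l v2]
        nctreeD(1)[of v1 r A3 l v2]
      by (auto simp: join_def pieces_def)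
  qed
  have vv: "v = v'" using v_le[OF p eq] v_le[OF q eq[symmetric]] by simp
  have m_le: "m2 \<le> m1" if p1: "pieces l m1 v r A1 A2 A3" and p2: "pieces l m2 v r B1 B2 B3"
    and e: "join l v A1 A2 A3 = join l v B1 B2 B3" for m1 m2 A1 A2 A3 B1 B2 B3
  proof (rule ccontr)
    assume "\<not> m2 \<le> m1"
    have o1: "l \<le> m1" "m1 < v" and o2: "l \<le> m2" "m2 < v"
      and a1: "nctree l m1 A1" and a2: "nctree (m1 + 1) v A2" and a3: "nctree v r A3"
      and b1: "nctree l m2 B1"
      using p1 p2 by (auto simp: pieces_def)
    have "(l, m1 + 1) \<in> (adj B1)\<^sup>*"
      using nctreeD(2)[OF b1, of l "m1 + 1"] o1 o2 \<open>\<not> m2 \<le> m1\<close> by auto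
    then obtain x y where "(x, y) \<in> adj B1" "x \<in> {..m1}" "y \<notin> {..m1}"
      by (rule rtrancl_exit[where X = "{..m1}"]) (use o1 in auto)
    then have xy: "(x, y) \<in> B1" "x \<le> m1" "m1 < y" "y < v"
      using nctreeD(1)[OF b1, of x y] nctreeD(1)[OF b1, of y x] o2 by (auto simp: adj_iff)
    then have "(x, y) \<in> join l v A1 A2 A3" using e by (auto simp: join_def)
    then show False
      using xy nctreeD(1)[OF a1, of x y] nctreeD(1)[OF a2, of x y] nctreeD(1)[OF a3, of x y] o1
      by (auto simp: join_def)
  qed
  have mm: "m = m'"
    using m_le[OF p _ eq[unfolded vv[symmetric]]] m_le[OF _ p eq[unfolded vv[symmetric], symmetric]]
      q vv by force
  have char: "A1 = {e \<in> join l v A1 A2 A3. snd e \<le> m} \<and>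
      A2 = {e \<in> join l v A1 A2 A3. m < fst e \<and> snd e \<le> v} \<and>
      A3 = {e \<in> join l v A1 A2 A3. v \<le> fst e}" if "pieces l m v r A1 A2 A3" for A1 A2 A3
  proof -
    have o1: "l \<le> m" "m < v"
      and a1: "nctree l m A1" and a2: "nctree (m + 1) v A2" and a3: "nctree v r A3"
      using that by (auto simp: pieces_def)
    have a: "\<And>x y. (x, y) \<in> A1 \<Longrightarrow> l \<le> x \<and> x < y \<and> y \<le> m"
      "\<And>x y. (x, y) \<in> A2 \<Longrightarrow> m + 1 \<le> x \<and> x < y \<and> y \<le> v"
      "\<And>x y. (x, y) \<in> A3 \<Longrightarrow> v \<le> x \<and> x < y \<and> y \<le> r"
      using nctreeD(1)[OF a1] nctreeD(1)[OF a2] nctreeD(1)[OF a3] by blast+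
    have "((x, y) \<in> A1 \<longleftrightarrow> (x, y) \<in> join l v A1 A2 A3 \<and> y \<le> m) \<and>
        ((x, y) \<in> A2 \<longleftrightarrow> (x, y) \<in> join l v A1 A2 A3 \<and> m < x \<and> y \<le> v) \<and>
        ((x, y) \<in> A3 \<longleftrightarrow> (x, y) \<in> join l v A1 A2 A3 \<and> v \<le> x)" for x y
      using a(1)[of x y] a(2)[of x y] a(3)[of x y] o1 by (auto simp: join_def)
    then show ?thesis by auto
  qed
  define J where "J = join l v P1 P2 P3"
  have JQ: "join l v Q1 Q2 Q3 = J" using eq vv by (simp add: J_def)
  have "pieces l m v r Q1 Q2 Q3" using q vv mm by simp
  note cP = char[OF p, folded J_def] and cQ = char[OF this, unfolded JQ]
  have "P1 = Q1" using cP[THEN conjunct1] cQ[THEN conjunct1] by (rule trans[OF _ sym])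
  moreover have "P2 = Q2"
    using cP[THEN conjunct2, THEN conjunct1] cQ[THEN conjunct2, THEN conjunct1] by (rule trans[OF _ sym])
  moreover have "P3 = Q3"
    using cP[THEN conjunct2, THEN conjunct2] cQ[THEN conjunct2, THEN conjunct2] by (rule trans[OF _ sym])
  ultimately show ?thesis using vv mm by blast
qed

lemma deg_join:
  assumes "pieces l m v r P1 P2 P3"
  shows "deg (join l v P1 P2 P3) l = Suc (deg P1 l)"
    and "\<And>x. l < x \<Longrightarrow> x \<le> m \<Longrightarrow> deg (join l v P1 P2 P3) x = deg P1 x"
    and "\<And>x. m < x \<Longrightarrow> x < v \<Longrightarrow> deg (join l v P1 P2 P3) x = deg P2 x"
    and "deg (join l v P1 P2 P3) v = Suc (deg P2 v + deg P3 v)"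
    and "\<And>x. v < x \<Longrightarrow> deg (join l v P1 P2 P3) x = deg P3 x"
proof -
  have o1: "l \<le> m" "m < v"
    and t1: "nctree l m P1" and t2: "nctree (m + 1) v P2" and t3: "nctree v r P3"
    using assms by (auto simp: pieces_def)
  have b: "\<And>x y. (x, y) \<in> P1 \<Longrightarrow> l \<le> x \<and> x < y \<and> y \<le> m"
    "\<And>x y. (x, y) \<in> P2 \<Longrightarrow> m + 1 \<le> x \<and> x < y \<and> y \<le> v"
    "\<And>x y. (x, y) \<in> P3 \<Longrightarrow> v \<le> x \<and> x < y \<and> y \<le> r"
    using nctreeD(1)[OF t1] nctreeD(1)[OF t2] nctreeD(1)[OF t3] by blast+
  note f = nctree_finite[OF t1] nctree_finite[OF t2] nctree_finite[OF t3]
  let ?E = "join l v P1 P2 P3"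
  have E: "(x, y) \<in> ?E \<longleftrightarrow> (x, y) = (l, v) \<or> (x, y) \<in> P1 \<or> (x, y) \<in> P2 \<or> (x, y) \<in> P3" for x y
    by (auto simp: join_def)
  have "(a, c) \<in> ?E \<and> (a = l \<or> c = l) \<longleftrightarrow> (a, c) = (l, v) \<or> (a, c) \<in> P1 \<and> (a = l \<or> c = l)" for a c
    using b(1)[of a c] b(2)[of a c] b(3)[of a c] o1 by (auto simp: join_def)
  then have "{e \<in> ?E. fst e = l \<or> snd e = l} = insert (l, v) {e \<in> P1. fst e = l \<or> snd e = l}"
    by (simp add: set_eq_iff)
  moreover have "(l, v) \<notin> P1" using b(1)[of l v] o1 by auto
  ultimately show "deg ?E l = Suc (deg P1 l)" using f by (simp add: deg_def)
  have "(a, c) \<in> ?E \<and> (a = x \<or> c = x) \<longleftrightarrow> (a, c) \<in> P1 \<and> (a = x \<or> c = x)"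
    if "l < x" "x \<le> m" for a c x
    using b(1)[of a c] b(2)[of a c] b(3)[of a c] o1 that by (auto simp: join_def)
  then show "deg ?E x = deg P1 x" if "l < x" "x \<le> m" for x
    using that unfolding deg_def by (intro arg_cong[where f = card]) (simp add: set_eq_iff)
  have "(a, c) \<in> ?E \<and> (a = x \<or> c = x) \<longleftrightarrow> (a, c) \<in> P2 \<and> (a = x \<or> c = x)"
    if "m < x" "x < v" for a c x
    using b(1)[of a c] b(2)[of a c] b(3)[of a c] o1 that by (auto simp: join_def)
  then show "deg ?E x = deg P2 x" if "m < x" "x < v" for x
    using that unfolding deg_def by (intro arg_cong[where f = card]) (simp add: set_eq_iff)
  have "(a, c) \<in> ?E \<and> (a = x \<or> c = x) \<longleftrightarrow> (a, c) \<in> P3 \<and> (a = x \<or> c = x)"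
    if "v < x" for a c x
    using b(1)[of a c] b(2)[of a c] b(3)[of a c] o1 that by (auto simp: join_def)
  then show "deg ?E x = deg P3 x" if "v < x" for x
    using that unfolding deg_def by (intro arg_cong[where f = card]) (simp add: set_eq_iff)
  have "(a, c) \<in> ?E \<and> (a = v \<or> c = v) \<longleftrightarrow>
      (a, c) = (l, v) \<or> (a, c) \<in> P2 \<and> (a = v \<or> c = v) \<or> (a, c) \<in> P3 \<and> (a = v \<or> c = v)" for a c
    using b(1)[of a c] b(2)[of a c] b(3)[of a c] o1 by (auto simp: join_def)
  then have "{e \<in> ?E. fst e = v \<or> snd e = v} =
      insert (l, v) ({e \<in> P2. fst e = v \<or> snd e = v} \<union> {e \<in> P3. fst e = v \<or> snd e = v})"
    by (simp add: set_eq_iff)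
  moreover have "(l, v) \<notin> P2" "(l, v) \<notin> P3" using b(2)[of l v] b(3)[of l v] o1 by auto
  moreover have "P2 \<inter> P3 = {}"
    using b(2,3) by force
  then have "card ({e \<in> P2. fst e = v \<or> snd e = v} \<union> {e \<in> P3. fst e = v \<or> snd e = v}) =
      deg P2 v + deg P3 v"
    using f unfolding deg_def by (intro card_Un_disjoint) auto
  ultimately show "deg ?E v = Suc (deg P2 v + deg P3 v)" using f by (simp add: deg_def)
qed

text \<open>The left end is a gluing vertex: other pieces may still contribute to its degree. Hence
  it is exempt from the condition \<open>A\<close>, and its degree is recorded instead.\<close>

definition ltrees :: "nat set \<Rightarrow> int \<Rightarrow> int \<Rightarrow> nat \<Rightarrow> (int \<times> int) set set" where
  "ltrees A l r i = {P. nctree l r P \<and> deg P l = i \<and> (\<forall>x. l < x \<longrightarrow> x \<le> r \<longrightarrow> deg P x \<in> A)}"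

definition rtrees :: "nat set \<Rightarrow> int \<Rightarrow> int \<Rightarrow> nat \<Rightarrow> (int \<times> int) set set" where
  "rtrees A l r i = {P. nctree l r P \<and> deg P r = i \<and> (\<forall>x. l \<le> x \<longrightarrow> x < r \<longrightarrow> deg P x \<in> A)}"

lemma finite_nctrees: "finite {P. nctree l r P}"
proof (rule finite_subset)
  show "{P. nctree l r P} \<subseteq> Pow ({l..r} \<times> {l..r})"
    by (auto dest: nctreeD(1))
qed simp

lemma finite_ltrees [simp]: "finite (ltrees A l r i)"
  by (rule finite_subset[OF _ finite_nctrees[of l r]]) (auto simp: ltrees_def)

lemma finite_rtrees [simp]: "finite (rtrees A l r i)"
  by (rule finite_subset[OF _ finite_nctrees[of l r]]) (auto simp: rtrees_def)

section \<open>Reflections, translations and the recursion for the counts\<close>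

definition refl_edges :: "int \<Rightarrow> (int \<times> int) set \<Rightarrow> (int \<times> int) set" where
  "refl_edges c P = (\<lambda>(x, y). (c - y, c - x)) ` P"

lemma refl_edges_iff: "(x, y) \<in> refl_edges c P \<longleftrightarrow> (c - y, c - x) \<in> P"
proof
  show "(x, y) \<in> refl_edges c P" if "(c - y, c - x) \<in> P"
    using that unfolding refl_edges_def by (rule rev_image_eqI) simp
qed (auto simp: refl_edges_def)

lemma refl_edges_refl_edges [simp]: "refl_edges c (refl_edges c P) = P"
  by (simp add: set_eq_iff refl_edges_iff)

lemma deg_refl_edges: "deg (refl_edges c P) x = deg P (c - x)"
proof -
  have "{e \<in> refl_edges c P. fst e = x \<or> snd e = x} = refl_edges c {e \<in> P. fst e = c - x \<or> snd e = c - x}"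
    by (simp add: set_eq_iff refl_edges_iff) blast
  moreover have "card (refl_edges c S) = card S" for S
    unfolding refl_edges_def by (rule card_image) (auto simp: inj_on_def)
  ultimately show ?thesis unfolding deg_def by simp
qed

lemma reach_refl_edges:
  assumes "(u, w) \<in> (adj (P :: (int \<times> int) set))\<^sup>*"
  shows "(c - u, c - w) \<in> (adj (refl_edges c P))\<^sup>*"
  by (rule rtrancl_map[OF assms]) (auto simp: adj_iff refl_edges_iff)

lemma nctree_refl_edges:
  assumes t: "nctree l r P"
  shows "nctree (c - r) (c - l) (refl_edges c P)"
  unfolding nctree_def
proof (intro conjI ballI allI impI)
  show "refl_edges c P \<subseteq> {(x, y). c - r \<le> x \<and> x < y \<and> y \<le> c - l}"
  proof clarify
    fix x y assume "(x, y) \<in> refl_edges c P"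
    then show "c - r \<le> x \<and> x < y \<and> y \<le> c - l"
      using nctreeD(1)[OF t, of "c - y" "c - x"] by (simp add: refl_edges_iff)
  qed
  fix u w assume "u \<in> {c - r..c - l}" "w \<in> {c - r..c - l}"
  then show "(u, w) \<in> (adj (refl_edges c P))\<^sup>*"
    using nctreeD(2)[OF t, of "c - u" "c - w"] reach_refl_edges[of "c - u" "c - w" P c] by simp
next
  fix x y assume xy: "(x, y) \<in> refl_edges c P"
  have *: "refl_edges c (refl_edges c P - {(x, y)}) = P - {(c - y, c - x)}"
  proof -
    have "(c - b = x \<and> c - a = y) = (a = c - y \<and> b = c - x)" for a b by arith
    then show ?thesis by (simp add: set_eq_iff refl_edges_iff)
  qed
  show "(x, y) \<notin> (adj (refl_edges c P - {(x, y)}))\<^sup>*"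
  proof
    assume "(x, y) \<in> (adj (refl_edges c P - {(x, y)}))\<^sup>*"
    then have "(c - x, c - y) \<in> (adj (P - {(c - y, c - x)}))\<^sup>*"
      using reach_refl_edges[of x y "refl_edges c P - {(x, y)}" c] unfolding * by simp
    then have "(c - y, c - x) \<in> (adj (P - {(c - y, c - x)}))\<^sup>*" by (rule reach_sym)
    then show False using nctreeD(3)[OF t, of "c - y" "c - x"] xy by (simp add: refl_edges_iff)
  qed
next
  fix a b k d assume "(a, k) \<in> refl_edges c P" "(b, d) \<in> refl_edges c P"
  then show "\<not> (a < b \<and> b < k \<and> k < d)"
    using nctreeD(4)[OF t, of "c - d" "c - b" "c - k" "c - a"] by (simp add: refl_edges_iff) blast
qed

lemma card_rtrees: "card (rtrees A l r i) = card (ltrees A (c - r) (c - l) i)"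
proof (rule bij_betw_same_card)
  show "bij_betw (refl_edges c) (rtrees A l r i) (ltrees A (c - r) (c - l) i)"
  proof (rule bij_betw_byWitness[where f' = "refl_edges c"])
    show "refl_edges c ` rtrees A l r i \<subseteq> ltrees A (c - r) (c - l) i"
      by (auto simp: rtrees_def ltrees_def deg_refl_edges nctree_refl_edges)
    show "refl_edges c ` ltrees A (c - r) (c - l) i \<subseteq> rtrees A l r i"
      using nctree_refl_edges[of "c - r" "c - l" _ c]
      by (auto simp: rtrees_def ltrees_def deg_refl_edges)
  qed auto
qed

definition ltree_count :: "nat set \<Rightarrow> nat \<Rightarrow> nat \<Rightarrow> nat" where
  "ltree_count A i n = card (ltrees A 0 (int n) i)"

text \<open>A translation is the composition of two reflections, so \<open>card_rtrees\<close> with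
  two different centres suffices.\<close>

lemma card_ltrees: "card (ltrees A l (l + int n) i) = ltree_count A i n"
  using card_rtrees[of A l "l + int n" i "l + int n"]
    card_rtrees[of A "- l - int n" "- l" i 0] card_rtrees[of A "- l - int n" "- l" i "- l"]
  by (simp add: ltree_count_def add.commute)

lemma card_rtrees': "card (rtrees A l (l + int n) i) = ltree_count A i n"
  using card_rtrees[of A l "l + int n" i "l + int n"] by (simp add: ltree_count_def)

text \<open>The edges at \<open>x\<close> inject into the other \<open>n\<close> vertices. This
  bound makes the later sums over degrees finite.\<close>

lemma deg_le:
  assumes t: "nctree l (l + int n) P" and "x \<in> {l..l + int n}"
  shows "deg P x \<le> n"
proof -
  have "deg P x \<le> card ({l..l + int n} - {x})"
    unfolding deg_def
  proof (rule card_inj_on_le[where f = "\<lambda>e. if fst e = x then snd e else fst e"])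
    have b: "l \<le> fst e \<and> fst e < snd e \<and> snd e \<le> l + int n" if "e \<in> P" for e
      using nctreeD(1)[OF t, of "fst e" "snd e"] that by simp
    show "inj_on (\<lambda>e. if fst e = x then snd e else fst e) {e \<in> P. fst e = x \<or> snd e = x}"
    proof (rule inj_onI, goal_cases)
      case (1 e e')
      then show ?case using b[of e] b[of e'] by (auto simp: prod_eq_iff split: if_splits)
    qed
    show "(\<lambda>e. if fst e = x then snd e else fst e) ` {e \<in> P. fst e = x \<or> snd e = x}
        \<subseteq> {l..l + int n} - {x}"
    proof (rule image_subsetI, goal_cases)
      case (1 e)
      then show ?case using b[of e] by auto
    qed
  qed auto
  also have "\<dots> = n" using assms(2) by (simp add: card_Diff_singleton)
  finally show ?thesis .
qed

lemma nctree_singleton: "nctree l l P \<longleftrightarrow> P = {}"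
  by (auto simp: nctree_def)

lemma ltree_count_0: "ltree_count A 0 n = (if n = 0 then 1 else 0)"
proof (cases "n = 0")
  case True
  then have "ltrees A 0 (int n) 0 = {{}}" by (auto simp: ltrees_def nctree_singleton deg_def)
  then show ?thesis using True by (simp add: ltree_count_def)
next
  case False
  have "deg P 0 \<noteq> 0" if t: "nctree 0 (int n) P" for P
  proof -
    obtain m v P1 P2 P3 where "pieces 0 m v (int n) P1 P2 P3" "P = join 0 v P1 P2 P3"
      by (rule nctree_split[OF t]) (use False in auto)
    then show ?thesis using deg_join(1) by simp
  qed
  then have "ltrees A 0 (int n) 0 = {}" by (auto simp: ltrees_def)
  then show ?thesis using False by (simp add: ltree_count_def)
qed

lemma ltree_count_Suc_0: "ltree_count A (Suc i) 0 = 0"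
  by (auto simp: ltree_count_def ltrees_def nctree_singleton deg_def)

text \<open>Splitting and gluing form a bijection. The three pieces have \<open>m\<close>,
  \<open>s\<close> and \<open>n - m - s\<close> edges, which with the splitting edge makes
  \<open>Suc n\<close>. The farthest neighbour of 0 has degrees \<open>p\<close> and
  \<open>q\<close> in its two wings, hence \<open>Suc (p + q)\<close> in the whole tree.\<close>

lemma ltree_count_Suc_Suc:
  "ltree_count A (Suc i) (Suc n) =
     (\<Sum>(m, s)\<in>(SIGMA m:{0..n}. {0..n - m}).
        \<Sum>(p, q)\<in>{(p, q). p \<le> n \<and> q \<le> n \<and> Suc (p + q) \<in> A}.
        ltree_count A i m * (ltree_count A p s * ltree_count A q (n - m - s)))"
proof -
  define I where "I = (SIGMA m:{0..n}. {0..n - m}) \<times> {(p, q). p \<le> n \<and> q \<le> n \<and> Suc (p + q) \<in> A}"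
  define B where "B = (\<lambda>((m, s), (p, q)). ltrees A 0 (int m) i \<times>
     (rtrees A (int m + 1) (int m + 1 + int s) p \<times>
      ltrees A (int m + 1 + int s) (int (Suc n)) q))"
  define J where "J = (\<lambda>(((m :: nat, s :: nat), (p :: nat, q :: nat)), (P1, P2, P3)).
     join 0 (int m + 1 + int s) P1 P2 P3)"
  have "finite {(p, q). p \<le> n \<and> q \<le> n \<and> Suc (p + q) \<in> A}"
    by (rule finite_subset[of _ "{..n} \<times> {..n}"]) auto
  then have fin: "finite I" unfolding I_def by auto
  have pcs: "pieces 0 (int m) (int m + 1 + int s) (int (Suc n)) P1 P2 P3"
    if "((m, s), (p, q)) \<in> I" "(P1, P2, P3) \<in> B ((m, s), (p, q))" for m s p q P1 P2 P3
    using that by (auto simp: I_def B_def pieces_def ltrees_def rtrees_def)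
  have "bij_betw J (SIGMA t:I. B t) (ltrees A 0 (int (Suc n)) (Suc i))"
  proof (rule bij_betw_imageI)
    show "inj_on J (SIGMA t:I. B t)"
    proof (rule inj_onI)
      fix X Y assume X: "X \<in> (SIGMA t:I. B t)" and Y: "Y \<in> (SIGMA t:I. B t)" and eq: "J X = J Y"
      obtain m s p q P1 P2 P3 where Xd: "X = (((m, s), (p, q)), (P1, P2, P3))" by (metis prod.exhaust)
      obtain m' s' p' q' Q1 Q2 Q3 where Yd: "Y = (((m', s'), (p', q')), (Q1, Q2, Q3))"
        by (metis prod.exhaust)
      have "int m = int m' \<and> int m + 1 + int s = int m' + 1 + int s' \<and> P1 = Q1 \<and> P2 = Q2 \<and> P3 = Q3"
      proof (rule join_inject)
        show "pieces 0 (int m) (int m + 1 + int s) (int (Suc n)) P1 P2 P3"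
          by (rule pcs) (use X Xd in auto)
        show "pieces 0 (int m') (int m' + 1 + int s') (int (Suc n)) Q1 Q2 Q3"
          by (rule pcs) (use Y Yd in auto)
        show "join 0 (int m + 1 + int s) P1 P2 P3 = join 0 (int m' + 1 + int s') Q1 Q2 Q3"
          using eq by (simp add: J_def Xd Yd)
      qed
      then show "X = Y" using X Y by (auto simp: Xd Yd B_def ltrees_def rtrees_def)
    qed
    show "J ` (SIGMA t:I. B t) = ltrees A 0 (int (Suc n)) (Suc i)"
    proof (intro set_eqI iffI)
      fix P assume "P \<in> J ` (SIGMA t:I. B t)"
      then obtain m s p q P1 P2 P3 where 1: "((m, s), (p, q)) \<in> I"
        and 2: "(P1, P2, P3) \<in> B ((m, s), (p, q))" and P: "P = join 0 (int m + 1 + int s) P1 P2 P3"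
        by (auto simp: J_def)
      note pc = pcs[OF 1 2]
      have "nctree 0 (int (Suc n)) P" using nctree_join[OF pc] P by simp
      moreover have "deg P 0 = Suc i" using deg_join(1)[OF pc] 2 P by (simp add: B_def ltrees_def)
      moreover have "deg P x \<in> A" if "0 < x" "x \<le> int (Suc n)" for x
      proof -
        consider "x \<le> int m" | "int m < x" "x < int m + 1 + int s" | "x = int m + 1 + int s"
          | "int m + 1 + int s < x" by linarith
        then show ?thesis
        proof cases
          case 1
          then show ?thesis using deg_join(2)[OF pc, of x] that 2 P by (simp add: B_def ltrees_def)
        next
          case c: 2
          then show ?thesis using deg_join(3)[OF pc, of x] that 2 P by (simp add: B_def rtrees_def)
        next
          case 3
          then show ?thesis using deg_join(4)[OF pc] 1 2 P
            by (simp add: B_def rtrees_def ltrees_def I_def)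
        next
          case 4
          then show ?thesis using deg_join(5)[OF pc, of x] that 2 P by (simp add: B_def ltrees_def)
        qed
      qed
      ultimately show "P \<in> ltrees A 0 (int (Suc n)) (Suc i)" by (simp add: ltrees_def)
    next
      fix P assume P: "P \<in> ltrees A 0 (int (Suc n)) (Suc i)"
      then have t: "nctree 0 (int (Suc n)) P" by (simp add: ltrees_def)
      obtain m' v P1 P2 P3 where pc': "pieces 0 m' v (int (Suc n)) P1 P2 P3"
        and J: "P = join 0 v P1 P2 P3"
        by (rule nctree_split[OF t]) auto
      define m where "m = nat m'"
      define s where "s = nat (v - m' - 1)"
      have o: "0 \<le> m'" "m' < v" "v \<le> int (Suc n)" using pc' by (auto simp: pieces_def)
      have v: "v = int m + 1 + int s" and m': "m' = int m" using o by (auto simp: m_def s_def)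
      note pc = pc'[unfolded v m']
      define p where "p = deg P2 v"
      define q where "q = deg P3 v"
      have t1: "nctree 0 (int m) P1" and t2: "nctree (int m + 1) v P2"
        and t3: "nctree v (int (Suc n)) P3" using pc by (auto simp: pieces_def v)
      have le: "m + s \<le> n" using o v by linarith
      have "p \<le> s" unfolding p_def
        by (rule deg_le[of "int m + 1"]) (use t2 v in auto)
      have "q \<le> n - m - s" unfolding q_def
        by (rule deg_le[of v]) (use t3 v le in \<open>auto simp: of_nat_diff algebra_simps\<close>)
      have dA: "deg P x \<in> A" if "0 < x" "x \<le> int (Suc n)" for x
        using P that by (auto simp: ltrees_def)
      have "Suc (p + q) \<in> A"
        using dA[of v] o deg_join(4)[OF pc'] J by (simp add: p_def q_def)
      then have I: "((m, s), (p, q)) \<in> I"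
        using le \<open>p \<le> s\<close> \<open>q \<le> n - m - s\<close> by (auto simp: I_def)
      have "deg P1 0 = i" using deg_join(1)[OF pc'] P J by (simp add: ltrees_def)
      moreover have "deg P1 x \<in> A" if "0 < x" "x \<le> int m" for x
        using deg_join(2)[OF pc', of x] dA[of x] that J m' o by simp
      ultimately have "P1 \<in> ltrees A 0 (int m) i" using t1 by (simp add: ltrees_def)
      moreover have "deg P2 x \<in> A" if "int m + 1 \<le> x" "x < v" for x
        using deg_join(3)[OF pc', of x] dA[of x] that J m' o by simp
      then have "P2 \<in> rtrees A (int m + 1) v p" using t2 by (simp add: rtrees_def p_def)
      moreover have "deg P3 x \<in> A" if "v < x" "x \<le> int (Suc n)" for x
        using deg_join(5)[OF pc', of x] dA[of x] that J m' o by simp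
      then have "P3 \<in> ltrees A v (int (Suc n)) q" using t3 by (simp add: ltrees_def q_def)
      ultimately have "(P1, P2, P3) \<in> B ((m, s), (p, q))" by (simp add: B_def v)
      with I show "P \<in> J ` (SIGMA t:I. B t)"
        by (intro image_eqI[where x = "(((m, s), (p, q)), (P1, P2, P3))"]) (auto simp: J_def J v)
    qed
  qed
  then have "ltree_count A (Suc i) (Suc n) = card (SIGMA t:I. B t)"
    unfolding ltree_count_def by (metis bij_betw_same_card)
  also have "\<dots> = (\<Sum>t\<in>I. card (B t))"
    using fin by (intro card_SigmaI) (auto simp: B_def)
  also have "\<dots> = (\<Sum>((m, s), (p, q))\<in>I.
      ltree_count A i m * (ltree_count A p s * ltree_count A q (n - m - s)))"
  proof (rule sum.cong, goal_cases)
    case (2 t)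
    obtain m s p q where t: "t = ((m, s), (p, q))" by (metis prod.exhaust)
    have "int (Suc n) = int m + 1 + int s + int (n - m - s)" using 2 by (auto simp: t I_def)
    then have "card (ltrees A (int m + 1 + int s) (int (Suc n)) q) = ltree_count A q (n - m - s)"
      by (simp only: card_ltrees)
    then show ?case
      by (simp only: t B_def prod.case card_cartesian_product card_rtrees' ltree_count_def[of A i m])
  qed auto
  also have "\<dots> = (\<Sum>(m, s)\<in>(SIGMA m:{0..n}. {0..n - m}).
      \<Sum>(p, q)\<in>{(p, q). p \<le> n \<and> q \<le> n \<and> Suc (p + q) \<in> A}.
        ltree_count A i m * (ltree_count A p s * ltree_count A q (n - m - s)))"
    unfolding I_def by (simp only: sum.cartesian_product split_def)
  finally show ?thesis .
qed

section \<open>Generating functions and Lagrange inversion\<close>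

text \<open>\<open>S = fps_X / phi\<close> is the compositional inverse of \<open>T\<close>, so
  \<open>H = G oo S\<close> for \<open>G = H oo T\<close>. Expanding \<open>fps_deriv H\<close> in
  powers of \<open>S\<close>, it remains to see that the coefficient of index \<open>n - 1\<close>
  in \<open>S ^ j * fps_deriv S * phi ^ n\<close> is 1 for \<open>j = n - 1\<close> and 0 for
  smaller \<open>j\<close>. This is the formal counterpart of the fact that a derivative has no
  residue.\<close>

lemma lagrange_inversion:
  fixes phi H T :: "'a :: field_char_0 fps"
  assumes phi0: "phi $ 0 \<noteq> 0" and T: "T = fps_X * (phi oo T)" and n: "n > 0"
  shows "of_nat n * (H oo T) $ n = (fps_deriv H * phi ^ n) $ (n - 1)"
proof -
  define S where "S = fps_X * inverse phi"
  have S0: "S $ 0 = 0" by (simp add: S_def)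
  have T0: "T $ 0 = 0" by (subst T) simp
  have "(fps_X * (phi oo T)) $ 1 = phi $ 0" by simp
  then have T1: "T $ 1 \<noteq> 0" using phi0 T by simp
  have S_phi: "S * phi = fps_X"
    using phi0 inverse_mult_eq_1[of phi] by (simp add: S_def mult.assoc)
  have ST: "S oo T = fps_X"
  proof -
    have "phi oo T \<noteq> 0" using phi0 by (metis fps_compose_nth_0 fps_zero_nth)
    moreover have "(S oo T) * (phi oo T) = T"
      using fps_compose_mult_distrib[OF T0, of S phi] T0 by (simp add: S_phi fps_X_fps_compose_startby0)
    ultimately show ?thesis using T by (metis mult_right_cancel)
  qed
  have "S = fps_inv T"
  proof -
    have "S = S oo (T oo fps_inv T)" using fps_inv_right[OF T0 T1] by simp
    also have "\<dots> = (S oo T) oo fps_inv T"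
      by (rule fps_compose_assoc) (simp_all add: T0 fps_inv_def)
    also have "\<dots> = fps_inv T" by (simp add: ST fps_X_fps_compose_startby0 fps_inv_def)
    finally show ?thesis .
  qed
  then have TS: "T oo S = fps_X" using fps_inv_right[OF T0 T1] by simp
  define G where "G = H oo T"
  have "H = G oo S"
    unfolding G_def using fps_compose_assoc[OF S0 T0, of H] by (simp add: TS)
  then have dH: "fps_deriv H = (fps_deriv G oo S) * fps_deriv S"
    using fps_compose_deriv[OF S0] by simp
  have pS: "phi * fps_deriv S = 1 - S * fps_deriv phi"
  proof -
    have "fps_deriv (S * phi) = 1" by (simp add: S_phi)
    then show ?thesis by (simp add: algebra_simps)
  qed
  \<comment> \<open>By \<open>S_phi\<close> and \<open>pS\<close> this is the coefficient of index
    \<open>e\<close> in \<open>phi ^ e - phi ^ e * S * fps_deriv phi\<close>. For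
    \<open>e > 0\<close> the subtracted series is \<open>fps_X * fps_deriv (phi ^ e)\<close> divided
    by \<open>e\<close>, whose coefficient of index \<open>e\<close> is that of
    \<open>phi ^ e\<close>, so the two cancel.\<close>
  have coeff: "(S ^ j * (fps_deriv S * phi ^ n)) $ (n - 1) = (if j = n - 1 then 1 else 0)"
    if j: "j \<le> n - 1" for j
  proof -
    define e where "e = n - 1 - j"
    have n_eq: "n = j + Suc e" using j n by (simp add: e_def)
    have "S ^ j * (fps_deriv S * phi ^ n) = (S * phi) ^ j * (phi ^ e * (phi * fps_deriv S))"
      unfolding n_eq by (simp add: power_add power_mult_distrib mult_ac)
    also have "\<dots> = fps_X ^ j * (phi ^ e * (1 - S * fps_deriv phi))"
      by (simp only: S_phi pS)
    finally have *: "(S ^ j * (fps_deriv S * phi ^ n)) $ (n - 1) = (phi ^ e * (1 - S * fps_deriv phi)) $ e"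
      using n_eq by (simp add: fps_X_power_mult_nth)
    show ?thesis
    proof (cases e)
      case 0
      then show ?thesis using * n_eq S0 by simp
    next
      case (Suc e')
      have "of_nat e * (phi ^ e * (S * fps_deriv phi)) = fps_X * fps_deriv (phi ^ e)"
      proof -
        have "fps_deriv (phi ^ e) = of_nat e * (fps_deriv phi * phi ^ e')"
          unfolding fps_deriv_power Suc by (simp add: fps_of_nat[symmetric] mult_ac del: of_nat_Suc power_Suc)
        then show ?thesis by (simp add: Suc mult_ac del: of_nat_Suc flip: S_phi)
      qed
      then have "(of_nat e * (phi ^ e * (S * fps_deriv phi))) $ e = of_nat e * (phi ^ e) $ e"
        by (simp add: Suc del: power_Suc)
      then have "of_nat e * (phi ^ e * (S * fps_deriv phi)) $ e = of_nat e * (phi ^ e) $ e"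
        by (simp add: fps_of_nat[symmetric] del: of_nat_Suc)
      then have "(phi ^ e * (S * fps_deriv phi)) $ e = (phi ^ e) $ e"
        using of_nat_neq_0[of e', where 'a = 'a] by (simp add: Suc del: of_nat_Suc power_Suc)
      then show ?thesis using * n_eq Suc by (simp add: right_diff_distrib)
    qed
  qed
  have "(fps_deriv H * phi ^ n) $ (n - 1) =
      ((fps_deriv G oo S) * (fps_deriv S * phi ^ n)) $ (n - 1)"
    by (simp add: dH mult.assoc)
  also have "\<dots> = (\<Sum>i=0..n - 1. (\<Sum>j=0..n - 1. fps_deriv G $ j * (S ^ j) $ i) *
      (fps_deriv S * phi ^ n) $ (n - 1 - i))"
    unfolding fps_mult_nth[of "fps_deriv G oo S"]
  proof (intro sum.cong refl arg_cong2[where f = "(*)"])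
    \<comment> \<open>\<open>S ^ j\<close> has no coefficient of index below \<open>j\<close>, so
      the inner sum may be extended to a range independent of \<open>i\<close>.\<close>
    fix i assume "i \<in> {0..n - 1}"
    then show "(fps_deriv G oo S) $ i = (\<Sum>j=0..n - 1. fps_deriv G $ j * (S ^ j) $ i)"
      unfolding fps_compose_nth
      by (intro sum.mono_neutral_left) (auto simp: startsby_zero_power_prefix[OF S0])
  qed
  also have "\<dots> = (\<Sum>j=0..n - 1. fps_deriv G $ j * (S ^ j * (fps_deriv S * phi ^ n)) $ (n - 1))"
    unfolding fps_mult_nth[of "S ^ _"] sum_distrib_left sum_distrib_right
    by (subst sum.swap) (simp add: mult.assoc)
  also have "\<dots> = (\<Sum>j=0..n - 1. if j = n - 1 then fps_deriv G $ j else 0)"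
    by (intro sum.cong refl) (simp add: coeff del: One_nat_def fps_deriv_nth)
  also have "\<dots> = of_nat n * G $ n" using n by simp
  finally show ?thesis by (simp add: G_def)
qed

section \<open>The functional equation of the butterfly series\<close>

lemma ltree_count_eq_0: "n < i \<Longrightarrow> ltree_count A i n = 0"
proof -
  assume "n < i"
  have "P \<notin> ltrees A 0 (int n) i" for P
    using deg_le[of 0 n P 0] \<open>n < i\<close> by (auto simp: ltrees_def)
  then have "ltrees A 0 (int n) i = {}" by blast
  then show ?thesis by (simp add: ltree_count_def)
qed

definition offspring_fps :: "nat set \<Rightarrow> real fps" where
  "offspring_fps A = Abs_fps (\<lambda>k. if Suc k \<in> A then real (Suc k) else 0)"

text \<open>The variable marks edges: the coefficient of index \<open>n\<close> belongs to trees
  with \<open>n + 1\<close> vertices.\<close>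

definition ltree_fps :: "nat set \<Rightarrow> nat \<Rightarrow> real fps" where
  "ltree_fps A i = Abs_fps (\<lambda>n. real (ltree_count A i n))"

text \<open>A tree in which the left end has degree one is an edge below which a butterfly hangs: a vertex
  with a tree to its left and a tree to its right.\<close>

definition butterfly_fps :: "nat set \<Rightarrow> real fps" where
  "butterfly_fps A = ltree_fps A 1"

lemma ltree_fps_nth_eq_0: "(ltree_fps A p * ltree_fps A q) $ k = 0" if "k < p \<or> k < q"
  unfolding fps_mult_nth
  by (rule sum.neutral) (use that in \<open>auto simp: ltree_fps_def ltree_count_eq_0\<close>)

lemma ltree_fps_Suc:
  "ltree_fps A (Suc i) = fps_X * (ltree_fps A i *
     Abs_fps (\<lambda>n. \<Sum>(p, q)\<in>{(p, q). p \<le> n \<and> q \<le> n \<and> Suc (p + q) \<in> A}.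
       (ltree_fps A p * ltree_fps A q) $ n))" (is "_ = fps_X * (_ * ?G)")
proof (rule fps_ext)
  fix N
  show "ltree_fps A (Suc i) $ N = (fps_X * (ltree_fps A i * ?G)) $ N"
  proof (cases N)
    case 0
    then show ?thesis by (simp add: ltree_fps_def ltree_count_Suc_0)
  next
    case (Suc n)
    define Q where "Q k = {(p, q). p \<le> k \<and> q \<le> k \<and> Suc (p + q) \<in> A}" for k
    have finQ: "finite (Q k)" for k
      by (rule finite_subset[of _ "{..k} \<times> {..k}"]) (auto simp: Q_def)
    let ?h = "\<lambda>m s (p, q). ltree_count A i m * (ltree_count A p s * ltree_count A q (n - m - s))"
    have "ltree_fps A (Suc i) $ N =
        real (\<Sum>(m, s)\<in>(SIGMA m:{0..n}. {0..n - m}). \<Sum>pq\<in>Q n. ?h m s pq)"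
      by (simp add: ltree_fps_def Suc ltree_count_Suc_Suc Q_def)
    also have "\<dots> = (\<Sum>m=0..n. \<Sum>s=0..n - m. \<Sum>pq\<in>Q n. real (?h m s pq))"
      by (subst sum.Sigma[symmetric]) simp_all
    also have "\<dots> = (\<Sum>m=0..n. ltree_fps A i $ m * (\<Sum>(p, q)\<in>Q n. (ltree_fps A p * ltree_fps A q) $ (n - m)))"
      unfolding sum_distrib_left
    proof (rule sum.cong[OF refl], subst sum.swap, rule sum.cong[OF refl], goal_cases)
      case (1 m pq)
      show ?case
        by (cases pq) (simp add: fps_mult_nth ltree_fps_def sum_distrib_left)
    qed
    also have "\<dots> = (\<Sum>m=0..n. ltree_fps A i $ m * ?G $ (n - m))"
    proof (intro sum.cong refl arg_cong2[where f = "(*)"])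
      fix m
      \<comment> \<open>Pairs with a degree above \<open>n - m\<close> contribute nothing. Shrinking
        \<open>Q n\<close> to \<open>Q (n - m)\<close> makes the second factor depend on
        \<open>n - m\<close> alone, so that a Cauchy product appears.\<close>
      have "(\<Sum>(p, q)\<in>Q n. (ltree_fps A p * ltree_fps A q) $ (n - m)) =
          (\<Sum>(p, q)\<in>Q (n - m). (ltree_fps A p * ltree_fps A q) $ (n - m))"
        by (rule sum.mono_neutral_right[OF finQ]) (auto simp: Q_def intro!: ltree_fps_nth_eq_0)
      then show "(\<Sum>(p, q)\<in>Q n. (ltree_fps A p * ltree_fps A q) $ (n - m)) = ?G $ (n - m)"
        by (simp add: Q_def)
    qed
    finally show ?thesis by (simp add: Suc fps_mult_nth[of "ltree_fps A i"])
  qed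
qed

lemma ltree_fps_0: "ltree_fps A 0 = 1"
  by (rule fps_ext) (simp add: ltree_fps_def ltree_count_0)

text \<open>Each step of the recursion removes one edge at the left end together with its butterfly.
  The case \<open>i = 0\<close>, where \<open>ltree_fps A 0 = 1\<close>, identifies the factor
  contributed by a step as \<open>butterfly_fps A\<close>.\<close>

lemma ltree_fps_eq_power: "ltree_fps A i = butterfly_fps A ^ i"
proof (induction i)
  case (Suc i)
  show ?case
    using ltree_fps_Suc[of A i] ltree_fps_Suc[of A 0]
    by (simp add: Suc ltree_fps_0 butterfly_fps_def mult_ac)
qed (simp add: ltree_fps_0)

lemma butterfly_fps_eq: "butterfly_fps A = fps_X * (offspring_fps A oo butterfly_fps A)"
proof -
  define T where "T = butterfly_fps A"
  have T0: "T $ 0 = 0" by (simp add: T_def butterfly_fps_def ltree_fps_def ltree_count_Suc_0[of A 0, simplified])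
  have "(\<Sum>(p, q)\<in>{(p, q). p \<le> n \<and> q \<le> n \<and> Suc (p + q) \<in> A}. (T ^ p * T ^ q) $ n) =
      (offspring_fps A oo T) $ n" for n
  proof -
    have "finite {(p, q). p \<le> n \<and> q \<le> n \<and> Suc (p + q) \<in> A}"
      by (rule finite_subset[of _ "{..n} \<times> {..n}"]) auto
    \<comment> \<open>\<open>T\<close> has no constant term, so pairs with \<open>p + q > n\<close>
      vanish and the square of indices shrinks to a triangle. Grouping by \<open>k = p + q\<close>
      then yields the weight \<open>k + 1\<close>.\<close>
    then have "(\<Sum>(p, q)\<in>{(p, q). p \<le> n \<and> q \<le> n \<and> Suc (p + q) \<in> A}. (T ^ p * T ^ q) $ n) =
        (\<Sum>(p, q)\<in>{(p, q). p + q \<le> n}. if Suc (p + q) \<in> A then (T ^ (p + q)) $ n else 0)"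
      by (intro sum.mono_neutral_cong finite_subset[of "{(p, q). p + q \<le> n}" "{..n} \<times> {..n}"])
        (auto simp: power_add[symmetric] startsby_zero_power_prefix[OF T0] split: if_splits)
    also have "\<dots> = (\<Sum>k\<le>n. \<Sum>i\<le>k. if Suc k \<in> A then (T ^ k) $ n else 0)"
      by (subst sum.triangle_reindex_eq) (auto intro!: sum.cong)
    also have "\<dots> = (\<Sum>k\<le>n. offspring_fps A $ k * (T ^ k) $ n)"
      by (intro sum.cong refl) (simp add: offspring_fps_def)
    finally show ?thesis by (simp add: fps_compose_nth atMost_atLeast0)
  qed
  then have "Abs_fps (\<lambda>n. \<Sum>(p, q)\<in>{(p, q). p \<le> n \<and> q \<le> n \<and> Suc (p + q) \<in> A}.
      (T ^ p * T ^ q) $ n) = offspring_fps A oo T"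
    by (simp add: fps_eq_iff)
  moreover have "T = fps_X * Abs_fps (\<lambda>n. \<Sum>(p, q)\<in>{(p, q). p \<le> n \<and> q \<le> n \<and> Suc (p + q) \<in> A}.
      (T ^ p * T ^ q) $ n)"
    using ltree_fps_Suc[of A 0] by (simp add: ltree_fps_eq_power T_def)
  ultimately show ?thesis by (simp add: T_def)
qed

section \<open>Noncrossing trees on the roots of unity\<close>

lemma successively_imp_rtrancl:
  "successively R c \<Longrightarrow> c \<noteq> [] \<Longrightarrow> (hd c, last c) \<in> {(x, y). R x y}\<^sup>*"
proof (induction R c rule: successively.induct)
  case (3 P x y xs)
  then have "(x, y) \<in> {(x, y). P x y}" "(y, last (y # xs)) \<in> {(x, y). P x y}\<^sup>*" by auto
  then show ?case by (simp add: converse_rtrancl_into_rtrancl)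
qed auto

text \<open>Loop erasure: when the next vertex already lies on the path, the path is cut back to
  it.\<close>

lemma rtrancl_imp_distinct_path:
  assumes "(u, v) \<in> {(x, y). R x y}\<^sup>*"
  obtains c where "c \<noteq> []" "hd c = u" "last c = v" "distinct c" "successively R c"
proof -
  have "\<exists>c. c \<noteq> [] \<and> hd c = u \<and> last c = v \<and> distinct c \<and> successively R c"
    using assms
  proof (induction rule: rtrancl_induct)
    case base
    show ?case by (intro exI[of _ "[u]"]) simp
  next
    case (step y z)
    then obtain c where c: "c \<noteq> []" "hd c = u" "last c = y" "distinct c" "successively R c" by blast
    show ?case
    proof (cases "z \<in> set c")
      case False
      then show ?thesis
        using c step.hyps by (intro exI[of _ "c @ [z]"]) (auto simp: successively_append_iff)
    next
      case True
      then obtain xs ys where xs: "c = xs @ z # ys" by (meson split_list)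
      have "successively R (xs @ [z])" using c(5) unfolding xs by (simp add: successively_append_iff)
      then show ?thesis
        using c xs by (intro exI[of _ "xs @ [z]"]) (cases xs; auto)
    qed
  qed
  then show ?thesis using that by blast
qed

text \<open>The closing edge of a cycle is bypassed by the rest of the cycle. Conversely, a path
  without repetition that joins the ends of an edge and avoids that edge closes up to a cycle; it
  has at least three vertices, since with two it would be the edge itself.\<close>

lemma acyclic_iff_bridges:
  "(\<nexists>c. graph_cycle E c) \<longleftrightarrow>
     (\<forall>u v. {u, v} \<in> E \<longrightarrow> u \<noteq> v \<longrightarrow> (u, v) \<notin> {(x, y). {x, y} \<in> E - {{u, v}}}\<^sup>*)"
proof (intro iffI allI impI notI)
  fix u v assume nc: "\<nexists>c. graph_cycle E c" and uv: "{u, v} \<in> E" "u \<noteq> v"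
    and path: "(u, v) \<in> {(x, y). {x, y} \<in> E - {{u, v}}}\<^sup>*"
  obtain c where c: "c \<noteq> []" "hd c = u" "last c = v" "distinct c"
    "successively (\<lambda>x y. {x, y} \<in> E - {{u, v}}) c"
    using rtrancl_imp_distinct_path[OF path] by blast
  obtain x c' where c': "c = x # c'" using c(1) by (cases c) auto
  have "c' \<noteq> []" using c uv c' by auto
  then obtain y c'' where c'': "c' = y # c''" by (cases c') auto
  have "c'' \<noteq> []" using c uv by (auto simp: c' c'')
  then have "length c \<ge> 3" by (cases c'') (auto simp: c' c'')
  moreover have "successively (\<lambda>x y. {x, y} \<in> E) c"
    using c(5) by (rule successively_mono) auto
  ultimately have "graph_cycle E c"
    using c uv by (simp add: graph_cycle_def insert_commute)
  then show False using nc by blast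
next
  assume br: "\<forall>u v. {u, v} \<in> E \<longrightarrow> u \<noteq> v \<longrightarrow> (u, v) \<notin> {(x, y). {x, y} \<in> E - {{u, v}}}\<^sup>*"
    and "\<exists>c. graph_cycle E c"
  then obtain c where c: "length c \<ge> 3" "distinct c" "successively (\<lambda>x y. {x, y} \<in> E) c"
    "{last c, hd c} \<in> E"
    by (auto simp: graph_cycle_def)
  have ne: "c \<noteq> []" using c(1) by auto
  have hl: "hd c = c ! 0" "last c = c ! (length c - 1)" using ne by (simp_all add: hd_conv_nth last_conv_nth)
  have hdl: "hd c \<noteq> last c" using c(1,2) ne by (simp add: hl nth_eq_iff_index_eq)
  have "successively (\<lambda>x y. {x, y} \<in> E - {{hd c, last c}}) c"
    unfolding successively_conv_nth
  proof (intro allI impI)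
    fix i assume i: "Suc i < length c"
    have "{c ! i, c ! Suc i} \<noteq> {hd c, last c}"
      using i c(1,2) ne by (auto simp: hl doubleton_eq_iff nth_eq_iff_index_eq)
    moreover have "{c ! i, c ! Suc i} \<in> E" using c(3) i by (simp add: successively_conv_nth)
    ultimately show "{c ! i, c ! Suc i} \<in> E - {{hd c, last c}}" by simp
  qed
  from successively_imp_rtrancl[OF this ne]
  have "(hd c, last c) \<in> {(x, y). {x, y} \<in> E - {{hd c, last c}}}\<^sup>*" .
  moreover have "{hd c, last c} \<in> E" using c(4) by (simp add: insert_commute)
  ultimately show False using br hdl by blast
qed

section \<open>Transport of graphs along an injective labelling\<close>

definition edge_image :: "('a \<Rightarrow> 'b) \<Rightarrow> ('a \<times> 'a) set \<Rightarrow> 'b set set" where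
  "edge_image f P = (\<lambda>(x, y). {f x, f y}) ` P"

context
  fixes f :: "'a :: linorder \<Rightarrow> 'b" and V :: "'a set"
  assumes inj: "inj_on f V"
begin

lemma edge_image_iff:
  assumes "P \<subseteq> {(x, y). x \<in> V \<and> y \<in> V \<and> x < y}" "x \<in> V" "y \<in> V"
  shows "{f x, f y} \<in> edge_image f P \<longleftrightarrow> (x, y) \<in> adj P"
proof
  assume "{f x, f y} \<in> edge_image f P"
  then obtain a b where ab: "(a, b) \<in> P" "{f x, f y} = {f a, f b}" by (auto simp: edge_image_def)
  then have "a \<in> V" "b \<in> V" using assms by auto
  then have "x = a \<and> y = b \<or> x = b \<and> y = a"
    using ab(2) inj assms by (auto simp: doubleton_eq_iff inj_on_eq_iff)
  then show "(x, y) \<in> adj P" using ab(1) by (auto simp: adj_iff)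
qed (auto simp: edge_image_def adj_iff insert_commute intro: rev_image_eqI)

lemma edge_image_reach:
  assumes P: "P \<subseteq> {(x, y). x \<in> V \<and> y \<in> V \<and> x < y}" and "u \<in> V" "w \<in> V"
  shows "(f u, f w) \<in> {(x, y). {x, y} \<in> edge_image f P}\<^sup>* \<longleftrightarrow> (u, w) \<in> (adj P)\<^sup>*"
proof
  let ?g = "inv_into V f"
  assume "(f u, f w) \<in> {(x, y). {x, y} \<in> edge_image f P}\<^sup>*"
  then have "(?g (f u), ?g (f w)) \<in> (adj P)\<^sup>*"
  proof (rule rtrancl_map[where h = ?g])
    fix x y assume xy: "(x, y) \<in> {(x, y). {x, y} \<in> edge_image f P}"
    then obtain a b where ab: "(a, b) \<in> P" "{x, y} = {f a, f b}" by (auto simp: edge_image_def)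
    then have V: "a \<in> V" "b \<in> V" using P by auto
    then have "x \<in> f ` V" "y \<in> f ` V" using ab(2) by (auto simp: doubleton_eq_iff)
    then have "(?g x, ?g y) \<in> adj P"
      using xy edge_image_iff[OF P, of "?g x" "?g y"] by (simp add: inv_into_into f_inv_into_f)
    then show "(?g x, ?g y) \<in> (adj P)\<^sup>*" by blast
  qed
  then show "(u, w) \<in> (adj P)\<^sup>*" using assms inj by simp
next
  assume "(u, w) \<in> (adj P)\<^sup>*"
  then show "(f u, f w) \<in> {(x, y). {x, y} \<in> edge_image f P}\<^sup>*"
  proof (rule rtrancl_map[where h = f])
    fix x y assume "(x, y) \<in> adj P"
    then have "{f x, f y} \<in> edge_image f P" by (subst edge_image_iff[OF P]) (use P in \<open>auto simp: adj_iff\<close>)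
    then show "(f x, f y) \<in> {(x, y). {x, y} \<in> edge_image f P}\<^sup>*" by blast
  qed
qed

lemma inj_on_edge: "inj_on (\<lambda>(x, y). {f x, f y}) {(x, y). x \<in> V \<and> y \<in> V \<and> x < y}"
proof (rule inj_onI, clarify, goal_cases)
  case (1 a b c d)
  then have "a = c \<and> b = d \<or> a = d \<and> b = c"
    using inj by (auto simp: doubleton_eq_iff inj_on_eq_iff)
  then show ?case using 1 by auto
qed

lemma edge_image_bij:
  "bij_betw (edge_image f) (Pow {(x, y). x \<in> V \<and> y \<in> V \<and> x < y})
     {E. \<forall>e\<in>E. e \<subseteq> f ` V \<and> card e = 2}"
proof -
  have "(\<lambda>(x, y). {f x, f y}) ` {(x, y). x \<in> V \<and> y \<in> V \<and> x < y} = {e. e \<subseteq> f ` V \<and> card e = 2}"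
  proof (intro set_eqI iffI)
    fix e assume "e \<in> {e. e \<subseteq> f ` V \<and> card e = 2}"
    then obtain x y where "e = {f x, f y}" "x \<in> V" "y \<in> V" "x \<noteq> y"
    proof -
      obtain a b where "e = {a, b}" "a \<noteq> b" using \<open>e \<in> _\<close> by (auto simp: card_2_iff)
      moreover from this obtain x y where "a = f x" "b = f y" "x \<in> V" "y \<in> V"
        using \<open>e \<in> _\<close> by auto
      ultimately show ?thesis using that[of x y] by blast
    qed
    then show "e \<in> (\<lambda>(x, y). {f x, f y}) ` {(x, y). x \<in> V \<and> y \<in> V \<and> x < y}"
      by (cases "x < y") (auto intro: rev_image_eqI[of "(x, y)"] rev_image_eqI[of "(y, x)"])
  qed (use inj in \<open>auto simp: card_insert_if inj_on_eq_iff\<close>)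
  then have "bij_betw (\<lambda>(x, y). {f x, f y}) {(x, y). x \<in> V \<and> y \<in> V \<and> x < y} {e. e \<subseteq> f ` V \<and> card e = 2}"
    using inj_on_edge by (simp add: bij_betw_def)
  from bij_betw_Pow[OF this] show ?thesis
    by (simp add: edge_image_def[abs_def] Pow_def subset_iff Ball_def)
qed

lemma vertex_degree_edge_image:
  assumes P: "P \<subseteq> {(x, y). x \<in> V \<and> y \<in> V \<and> x < y}" and "x \<in> V"
  shows "vertex_degree (edge_image f P) (f x) = deg P x"
proof -
  have "f x \<in> {f a, f b} \<longleftrightarrow> a = x \<or> b = x" if "(a, b) \<in> P" for a b
    using that P assms(2) inj by (auto simp: inj_on_eq_iff)
  then have "{e \<in> edge_image f P. f x \<in> e} = (\<lambda>(x, y). {f x, f y}) ` {e \<in> P. fst e = x \<or> snd e = x}"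
    by (force simp: edge_image_def)
  moreover have "inj_on (\<lambda>(x, y). {f x, f y}) {e \<in> P. fst e = x \<or> snd e = x}"
    by (rule inj_on_subset[OF inj_on_edge]) (use P in auto)
  ultimately show ?thesis by (simp add: vertex_degree_def deg_def card_image)
qed

lemma tree_on_edge_image:
  assumes P: "P \<subseteq> {(x, y). x \<in> V \<and> y \<in> V \<and> x < y}" and "V \<noteq> {}"
  shows "tree_on (f ` V) (edge_image f P) \<longleftrightarrow>
    (\<forall>u\<in>V. \<forall>w\<in>V. (u, w) \<in> (adj P)\<^sup>*) \<and>
    (\<forall>x y. (x, y) \<in> P \<longrightarrow> (x, y) \<notin> (adj (P - {(x, y)}))\<^sup>*)"
proof -
  have "edge_image f P \<in> {E. \<forall>e\<in>E. e \<subseteq> f ` V \<and> card e = 2}"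
    using edge_image_bij P unfolding bij_betw_def by blast
  then have 1: "\<forall>e\<in>edge_image f P. e \<subseteq> f ` V \<and> card e = 2" by simp
  have 2: "connected_graph (f ` V) (edge_image f P) \<longleftrightarrow> (\<forall>u\<in>V. \<forall>w\<in>V. (u, w) \<in> (adj P)\<^sup>*)"
    using edge_image_reach[OF P] \<open>V \<noteq> {}\<close> by (simp add: connected_graph_def)
  have del: "edge_image f P - {{f x, f y}} = edge_image f (P - {(x, y)})" if "(x, y) \<in> P" for x y
  proof -
    have "edge_image f (P - {(x, y)}) = edge_image f P - edge_image f {(x, y)}"
      unfolding edge_image_def by (rule inj_on_image_set_diff[OF inj_on_edge]) (use P that in auto)
    then show ?thesis by (simp add: edge_image_def)
  qed
  have bridge: "(f x, f y) \<in> {(s, t). {s, t} \<in> edge_image f P - {{f x, f y}}}\<^sup>* \<longleftrightarrow>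
      (x, y) \<in> (adj (P - {(x, y)}))\<^sup>*" if "(x, y) \<in> P" for x y
    unfolding del[OF that] by (rule edge_image_reach) (use P that in auto)
  have 3: "(\<nexists>c. graph_cycle (edge_image f P) c) \<longleftrightarrow>
    (\<forall>x y. (x, y) \<in> P \<longrightarrow> (x, y) \<notin> (adj (P - {(x, y)}))\<^sup>*)"
    unfolding acyclic_iff_bridges
  proof (intro iffI allI impI)
    fix x y assume *: "\<forall>u v. {u, v} \<in> edge_image f P \<longrightarrow> u \<noteq> v \<longrightarrow>
        (u, v) \<notin> {(x, y). {x, y} \<in> edge_image f P - {{u, v}}}\<^sup>*" and xy: "(x, y) \<in> P"
    have e: "{f x, f y} \<in> edge_image f P" using xy by (auto simp: edge_image_def intro: rev_image_eqI)
    have ne: "f x \<noteq> f y" using xy P inj by (auto simp: inj_on_eq_iff)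
    show "(x, y) \<notin> (adj (P - {(x, y)}))\<^sup>*"
      unfolding bridge[OF xy, symmetric] by (rule *[rule_format, OF e ne])
  next
    fix u v assume *: "\<forall>x y. (x, y) \<in> P \<longrightarrow> (x, y) \<notin> (adj (P - {(x, y)}))\<^sup>*"
      and uv: "{u, v} \<in> edge_image f P"
    then obtain x y where xy: "(x, y) \<in> P" "{u, v} = {f x, f y}" by (auto simp: edge_image_def)
    let ?R = "{(s, t). {s, t} \<in> edge_image f P - {{f x, f y}}}"
    have nR: "(f x, f y) \<notin> ?R\<^sup>*"
      unfolding bridge[OF xy(1)] using * xy(1) by simp
    \<comment> \<open>The unordered edge may be named with its ends in either order, so the bridge
      property of the increasing pair is needed for the reversed pair as well.\<close>
    have "sym ?R" by (auto simp: sym_def insert_commute)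
    then have nR': "(f y, f x) \<notin> ?R\<^sup>*" using nR symD[OF sym_rtrancl[of ?R]] by blast
    have "u = f x \<and> v = f y \<or> u = f y \<and> v = f x" using xy(2) by (simp add: doubleton_eq_iff)
    then have "(u, v) \<notin> ?R\<^sup>*" using nR nR' by (elim disjE conjE) simp_all
    then show "(u, v) \<notin> {(s, t). {s, t} \<in> edge_image f P - {{u, v}}}\<^sup>*"
      unfolding xy(2) .
  qed
  show ?thesis unfolding tree_on_def using 1 2 3 by simp
qed

end

section \<open>Signed areas and chords (\<open>orient\<close> is twice the signed area of a
  triangle)\<close>

definition orient :: "complex \<Rightarrow> complex \<Rightarrow> complex \<Rightarrow> real" where
  "orient a b c = (Re b - Re a) * (Im c - Im a) - (Im b - Im a) * (Re c - Re a)"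

lemma orient_rotate: "orient b c a = orient a b c"
  and orient_swap: "orient b a c = - orient a b c"
  and orient_same [simp]: "orient a b a = 0" "orient a b b = 0"
  by (simp_all add: orient_def algebra_simps)

lemma orient_segment:
  "orient a b ((1 - t) *\<^sub>R u + t *\<^sub>R w) = (1 - t) * orient a b u + t * orient a b w"
  by (simp add: orient_def algebra_simps)

text \<open>Four points of the plane satisfy an affine dependence whose coefficients are, up to
  sign, the areas of the triangles opposite to them. With all four orientations positive it writes
  one point \<open>p\<close> as a convex combination both of \<open>a\<close>, \<open>c\<close> and
  of \<open>b\<close>, \<open>d\<close>.\<close>

lemma closed_segments_cross:
  assumes "orient a b c > 0" "orient b c d > 0" "orient a c d > 0" "orient a b d > 0"
  shows "closed_segment a c \<inter> closed_segment b d \<noteq> {}"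
proof -
  define s where "s = orient b c d + orient a b d"
  have s: "s > 0" using assms by (simp add: s_def)
  have s': "s = orient a c d + orient a b c" by (simp add: s_def orient_def algebra_simps)
  have eq: "orient b c d *\<^sub>R a + orient a b d *\<^sub>R c = orient a c d *\<^sub>R b + orient a b c *\<^sub>R d"
    by (rule complex_eqI) (simp_all add: orient_def algebra_simps)
  define p where "p = (orient b c d / s) *\<^sub>R a + (orient a b d / s) *\<^sub>R c"
  have "p = (1 - orient a b d / s) *\<^sub>R a + (orient a b d / s) *\<^sub>R c"
    using s by (simp add: p_def s_def field_simps)
  moreover have "0 \<le> orient a b d / s" "orient a b d / s \<le> 1"
    using assms s by (simp_all add: s_def)
  ultimately have 1: "p \<in> closed_segment a c" by (auto simp: closed_segment_def)
  have "p = (1 / s) *\<^sub>R (orient b c d *\<^sub>R a + orient a b d *\<^sub>R c)"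
    by (simp add: p_def scaleR_add_right)
  also have "\<dots> = (orient a c d / s) *\<^sub>R b + (orient a b c / s) *\<^sub>R d"
    unfolding eq by (simp add: scaleR_add_right)
  also have "\<dots> = (1 - orient a b c / s) *\<^sub>R b + (orient a b c / s) *\<^sub>R d"
    using s by (simp add: s' field_simps)
  moreover have "0 \<le> orient a b c / s" "orient a b c / s \<le> 1"
    using assms s by (simp_all add: s')
  ultimately have "p \<in> closed_segment b d" by (auto simp: closed_segment_def)
  with 1 show ?thesis by blast
qed

lemma closed_segment_orient_eq_0: "p \<in> closed_segment a b \<Longrightarrow> orient a b p = 0"
  by (auto simp: closed_segment_def orient_segment)

lemma closed_segment_orient_pos:
  "p \<in> closed_segment u w \<Longrightarrow> orient a b u > 0 \<Longrightarrow> orient a b w > 0 \<Longrightarrow> orient a b p > 0"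
proof -
  assume "p \<in> closed_segment u w" and pos: "orient a b u > 0" "orient a b w > 0"
  then obtain t where t: "0 \<le> t" "t \<le> 1" "p = (1 - t) *\<^sub>R u + t *\<^sub>R w"
    by (auto simp: closed_segment_def)
  show ?thesis
  proof (cases "t = 0")
    case False
    then have "t * orient a b w > 0" "(1 - t) * orient a b u \<ge> 0" using t pos by auto
    then show ?thesis by (simp add: t(3) orient_segment)
  qed (use t pos in simp)
qed

text \<open>\<open>orient a b\<close> is affine; it vanishes on the first segment, and on the second
  only at \<open>a\<close>.\<close>

lemma closed_segments_common_endpoint:
  assumes "orient a b c \<noteq> 0"
  shows "closed_segment a b \<inter> closed_segment a c \<subseteq> {a}"
proof
  fix p assume p: "p \<in> closed_segment a b \<inter> closed_segment a c"
  then obtain t where t: "p = (1 - t) *\<^sub>R a + t *\<^sub>R c" by (auto simp: closed_segment_def)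
  have "orient a b p = 0" using p closed_segment_orient_eq_0 by blast
  then have "t = 0" using assms by (simp add: t orient_segment)
  with t show "p \<in> {a}" by simp
qed

definition root_of_unity :: "nat \<Rightarrow> int \<Rightarrow> complex" where
  "root_of_unity n k = cis (2 * pi * real_of_int k / real n)"

lemma bij_betw_root_of_unity:
  assumes "n > 0"
  shows "bij_betw (root_of_unity n) {0..int n - 1} (unity_roots n)"
proof -
  have "bij_betw int {..<n} {0..int n - 1}"
    by (rule bij_betw_byWitness[where f' = nat]) auto
  moreover have "bij_betw (root_of_unity n \<circ> int) {..<n} (unity_roots n)"
    using Complex.bij_betw_roots_unity[OF assms]
    by (simp add: root_of_unity_def unity_roots_def comp_def)
  ultimately show ?thesis using bij_betw_comp_iff by blast
qed

lemma orient_cis: "orient (cis x) (cis y) (cis z) = 4 * sin ((y - x) / 2) * sin ((z - y) / 2) * sin ((z - x) / 2)"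
proof -
  define u where "u = (y - x) / 2"
  define w where "w = (z - y) / 2"
  have "orient (cis x) (cis y) (cis z) = sin (y - x) + sin (z - y) - sin (z - x)"
    by (simp add: orient_def sin_diff algebra_simps)
  also have "\<dots> = sin (2 * u) + sin (2 * w) - sin (2 * (u + w))"
  proof -
    have "2 * u = y - x" "2 * w = z - y" "2 * (u + w) = z - x"
      unfolding u_def w_def by (simp_all add: field_simps)
    then show ?thesis by (simp only:)
  qed
  also have "\<dots> = 4 * sin u * sin w * sin (u + w)"
  proof -
    have "sin u * cos u * (1 - cos w ^ 2) = sin u * cos u * sin w ^ 2"
      "sin w * cos w * (1 - cos u ^ 2) = sin w * cos w * sin u ^ 2"
      by (simp_all add: sin_squared_eq)
    then show ?thesis
      unfolding sin_double sin_add cos_add by (simp add: algebra_simps power2_eq_square sin_squared_eq)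
  qed
  also have "u + w = (z - x) / 2" by (simp add: u_def w_def field_simps)
  finally show ?thesis by (simp add: u_def w_def)
qed

text \<open>For increasing angles within one turn the half differences in \<open>orient_cis\<close>
  lie strictly between 0 and pi, where the sine is positive.\<close>

lemma orient_root_of_unity_pos:
  assumes "0 \<le> i" "i < j" "j < k" "k < int n"
  shows "orient (root_of_unity n i) (root_of_unity n j) (root_of_unity n k) > 0"
proof -
  have n: "real n > 0" using assms by simp
  have pos: "sin ((2 * pi * real_of_int b / real n - 2 * pi * real_of_int a / real n) / 2) > 0"
    if "a < b" "0 \<le> a" "b < int n" for a b
  proof -
    have "(2 * pi * real_of_int b / real n - 2 * pi * real_of_int a / real n) / 2 =
        pi * (real_of_int (b - a) / real n)"
      using n by (simp add: field_simps)
    moreover have "0 < sin (pi * q)" if "0 < q" "q < 1" for q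
      using that by (intro sin_gt_zero) simp_all
    moreover have "0 < real_of_int (b - a) / real n" "real_of_int (b - a) / real n < 1"
      using that n by simp_all
    ultimately show ?thesis by metis
  qed
  show ?thesis
    unfolding root_of_unity_def orient_cis using assms by (intro mult_pos_pos pos) auto
qed

lemma orient_root_of_unity_nonzero:
  assumes "i \<in> {0..<int n}" "j \<in> {0..<int n}" "k \<in> {0..<int n}" "i \<noteq> j" "j \<noteq> k" "i \<noteq> k"
  shows "orient (root_of_unity n i) (root_of_unity n j) (root_of_unity n k) \<noteq> 0"
proof -
  let ?z = "root_of_unity n"
  have *: "orient (?z i) (?z j) (?z k) \<noteq> 0"
    if h: "i \<in> {0..<int n}" "j \<in> {0..<int n}" "k \<in> {0..<int n}" "i < j" "j \<noteq> k" "i \<noteq> k" for i j k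
  proof -
    consider "k < i" | "i < k" "k < j" | "j < k" using h by linarith
    then show ?thesis
    proof cases
      case 1
      then show ?thesis
        using orient_root_of_unity_pos[of k i j n] h orient_rotate[of "?z i" "?z j" "?z k"] by simp
    next
      case 2
      then show ?thesis
        using orient_root_of_unity_pos[of i k j n] h orient_rotate[of "?z i" "?z k" "?z j"]
          orient_swap[of "?z i" "?z j" "?z k"] by simp
    next
      case 3
      then show ?thesis using orient_root_of_unity_pos[of i j k n] h by simp
    qed
  qed
  show ?thesis
  proof (cases "i < j")
    case True
    then show ?thesis using * assms by blast
  next
    case False
    then have "orient (?z j) (?z i) (?z k) \<noteq> 0" using * assms by (metis linorder_less_linear)
    then show ?thesis using orient_swap[of "?z j" "?z i" "?z k"] by simp
  qed
qed

text \<open>Both ends of one chord lie strictly on the same side of the line through the other, and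
  so does the whole chord by convexity.\<close>

lemma chords_disjoint:
  assumes "0 \<le> x" "x < y" "y < int n" "0 \<le> u" "u < w" "w < int n"
    and "y < u \<or> x < u \<and> w < y"
  shows "closed_segment (root_of_unity n x) (root_of_unity n y) \<inter>
         closed_segment (root_of_unity n u) (root_of_unity n w) = {}"
proof -
  let ?z = "root_of_unity n"
  have False if p: "p \<in> closed_segment (?z x) (?z y)" "p \<in> closed_segment (?z u) (?z w)" for p
    using assms(7)
  proof
    assume "y < u"
    then have "orient (?z x) (?z y) p > 0"
      using assms p by (intro closed_segment_orient_pos[OF p(2)] orient_root_of_unity_pos) auto
    then show False using closed_segment_orient_eq_0[OF p(1)] by simp
  next
    assume uw: "x < u \<and> w < y"
    \<comment> \<open>The inner chord lies to the right of the line from \<open>x\<close> to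
      \<open>y\<close>; reversing the line makes the sign positive.\<close>
    have "orient (?z y) (?z x) (?z k) > 0" if "x < k" "k < y" for k
      using orient_root_of_unity_pos[of x k y n] that assms orient_rotate[of "?z x" "?z k" "?z y"]
        orient_rotate[of "?z k" "?z y" "?z x"] by simp
    then have "orient (?z y) (?z x) p > 0"
      using assms uw by (intro closed_segment_orient_pos[OF p(2)]) auto
    then show False using closed_segment_orient_eq_0[of p "?z y" "?z x"] p(1)
      by (simp add: closed_segment_commute)
  qed
  then show ?thesis by blast
qed

text \<open>Interleaved chords meet but have no common endpoint. Distinct chords that are not
  interleaved either share exactly one endpoint, where the claim holds because three roots of unity
  are never collinear, or fall under \<open>chords_disjoint\<close>.\<close>

lemma chords_noncrossing_iff:
  assumes "0 \<le> x" "x < y" "y < int n" "0 \<le> u" "u < w" "w < int n" "(x, y) \<noteq> (u, w)"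
  defines "z \<equiv> root_of_unity n"
  shows "convex hull {z x, z y} \<inter> convex hull {z u, z w} \<subseteq> {z x, z y} \<inter> {z u, z w} \<longleftrightarrow>
    \<not> (x < u \<and> u < y \<and> y < w) \<and> \<not> (u < x \<and> x < w \<and> w < y)"
proof -
  have "inj_on z {0..int n - 1}"
    using bij_betw_root_of_unity[of n] assms by (auto simp: bij_betw_def)
  then have inj: "z i = z j \<longleftrightarrow> i = j" if "0 \<le> i" "i < int n" "0 \<le> j" "j < int n" for i j
    using that by (auto simp: inj_on_def)
  have cross: "\<not> convex hull {z a, z c} \<inter> convex hull {z b, z d} \<subseteq> {z a, z c} \<inter> {z b, z d}"
    if "0 \<le> a" "a < b" "b < c" "c < d" "d < int n" for a b c d
  proof -
    have "closed_segment (z a) (z c) \<inter> closed_segment (z b) (z d) \<noteq> {}"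
      unfolding z_def using that by (intro closed_segments_cross orient_root_of_unity_pos) auto
    moreover have "{z a, z c} \<inter> {z b, z d} = {}" using that by (auto simp: inj)
    ultimately show ?thesis by (simp add: segment_convex_hull)
  qed
  have common: "closed_segment (z i) (z j) \<inter> closed_segment (z i) (z k) \<subseteq> {z i}"
    if "i \<in> {0..<int n}" "j \<in> {0..<int n}" "k \<in> {0..<int n}" "i \<noteq> j" "j \<noteq> k" "i \<noteq> k" for i j k
    unfolding z_def by (rule closed_segments_common_endpoint[OF orient_root_of_unity_nonzero[OF that]])
  have nocross: "closed_segment (z x) (z y) \<inter> closed_segment (z u) (z w) \<subseteq> {z x, z y} \<inter> {z u, z w}"
    if h: "\<not> (x < u \<and> u < y \<and> y < w)" "\<not> (u < x \<and> x < w \<and> w < y)"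
  proof -
    consider "x = u" "y \<noteq> w" | "x = w" "y \<noteq> u" | "y = u" "x \<noteq> w" | "y = w" "x \<noteq> u"
      | "y < u \<or> x < u \<and> w < y" | "w < x \<or> u < x \<and> y < w"
      using h assms(1-7) by fastforce
    then show ?thesis
    proof cases
      case 1
      then show ?thesis using common[of x y w] assms(1-6) by auto
    next
      case 2
      then show ?thesis using common[of x y u] assms(1-6) by (auto simp: closed_segment_commute)
    next
      case 3
      then show ?thesis using common[of y x w] assms(1-6) by (auto simp: closed_segment_commute)
    next
      case 4
      then show ?thesis using common[of y x u] assms(1-6) by (auto simp: closed_segment_commute)
    next
      case 5
      then show ?thesis using chords_disjoint[of x y n u w] assms(1-6) by (simp add: z_def)
    next
      case 6
      then show ?thesis using chords_disjoint[of u w n x y] assms(1-6) by (simp add: z_def Int_commute)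
    qed
  qed
  show ?thesis
    using cross[of x u y w] cross[of u x w y] nocross assms(1-6)
    by (auto simp: segment_convex_hull Int_commute)
qed

section \<open>From trees in the disk to trees on an interval, and their number\<close>

lemma bij_betw_NC:
  assumes n: "n > 0"
  shows "bij_betw (edge_image (root_of_unity n))
    {P. nctree 0 (int n - 1) P \<and> (\<forall>x\<in>{0..int n - 1}. deg P x \<in> A)} (NC n A)"
proof -
  let ?z = "root_of_unity n" and ?V = "{0..int n - 1}"
  let ?U = "Pow {(x, y). x \<in> ?V \<and> y \<in> ?V \<and> x < y}"
  have inj: "inj_on ?z ?V" and img: "?z ` ?V = unity_roots n"
    using bij_betw_root_of_unity[OF n] by (auto simp: bij_betw_def)
  note bij = edge_image_bij[OF inj]
  have V: "?V \<noteq> {}" using n by simp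
  have iff: "edge_image ?z P \<in> NC n A \<longleftrightarrow>
      nctree 0 (int n - 1) P \<and> (\<forall>x\<in>?V. deg P x \<in> A)" if P: "P \<in> ?U" for P
  proof -
    have sub: "P \<subseteq> {(x, y). x \<in> ?V \<and> y \<in> ?V \<and> x < y}" using P by simp
    have cross: "convex hull {?z x, ?z y} \<inter> convex hull {?z u, ?z w} \<subseteq> {?z x, ?z y} \<inter> {?z u, ?z w} \<longleftrightarrow>
        \<not> (x < u \<and> u < y \<and> y < w) \<and> \<not> (u < x \<and> x < w \<and> w < y)"
      if "(x, y) \<in> P" "(u, w) \<in> P" "(x, y) \<noteq> (u, w)" for x y u w
      using that sub by (intro chords_noncrossing_iff) auto
    have neq: "{?z x, ?z y} \<noteq> {?z u, ?z w}" if "(x, y) \<in> P" "(u, w) \<in> P" "(x, y) \<noteq> (u, w)" for x y u w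
    proof
      assume "{?z x, ?z y} = {?z u, ?z w}"
      then have "(x, y) = (u, w)" using that sub by (intro inj_onD[OF inj_on_edge[OF inj]]) auto
      then show False using that by blast
    qed
    have nc: "(\<forall>e\<in>edge_image ?z P. \<forall>f\<in>edge_image ?z P. e \<noteq> f \<longrightarrow>
          convex hull e \<inter> convex hull f \<subseteq> e \<inter> f) \<longleftrightarrow>
        (\<forall>a b c d. (a, c) \<in> P \<longrightarrow> (b, d) \<in> P \<longrightarrow> \<not> (a < b \<and> b < c \<and> c < d))" (is "?L \<longleftrightarrow> ?R")
    proof (intro iffI allI impI notI)
      fix a b c d assume L: ?L and ac: "(a, c) \<in> P" and bd: "(b, d) \<in> P" and o: "a < b \<and> b < c \<and> c < d"
      have e: "{?z a, ?z c} \<in> edge_image ?z P" "{?z b, ?z d} \<in> edge_image ?z P"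
        using ac bd by (auto simp: edge_image_def intro: rev_image_eqI)
      have ne: "(a, c) \<noteq> (b, d)" using o by auto
      show False
        using L[rule_format, OF e neq[OF ac bd ne]] cross[OF ac bd ne] o by simp
    next
      assume R: ?R
      show ?L
      proof (intro ballI impI)
        fix e f assume ef: "e \<in> edge_image ?z P" "f \<in> edge_image ?z P" "e \<noteq> f"
        then obtain x y u w where xy: "(x, y) \<in> P" "e = {?z x, ?z y}" and uw: "(u, w) \<in> P" "f = {?z u, ?z w}"
          by (auto simp: edge_image_def)
        have ne: "(x, y) \<noteq> (u, w)" using ef xy uw by auto
        show "convex hull e \<inter> convex hull f \<subseteq> e \<inter> f"
          unfolding xy(2) uw(2) cross[OF xy(1) uw(1) ne]
          using R xy(1) uw(1) by blast
      qed
    qed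
    have "P \<subseteq> {(x, y). 0 \<le> x \<and> x < y \<and> y \<le> int n - 1}" using sub by auto
    moreover have "(\<forall>v\<in>unity_roots n. vertex_degree (edge_image ?z P) v \<in> A) \<longleftrightarrow> (\<forall>x\<in>?V. deg P x \<in> A)"
      unfolding img[symmetric] using vertex_degree_edge_image[OF inj sub] by auto
    ultimately show ?thesis
      unfolding NC_def noncrossing_tree_def mem_Collect_eq nctree_def nc img[symmetric]
        tree_on_edge_image[OF inj sub V]
      using n by simp
  qed
  have restrict: "bij_betw g {x \<in> S. g x \<in> N} {y \<in> T. y \<in> N}" if "bij_betw g S T"
    for g :: "(int \<times> int) set \<Rightarrow> complex set set" and S T N
    unfolding bij_betw_def
  proof
    show "inj_on g {x \<in> S. g x \<in> N}" using that by (auto simp: bij_betw_def intro: inj_on_subset)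
    have "T = g ` S" using that by (simp add: bij_betw_def)
    then show "g ` {x \<in> S. g x \<in> N} = {y \<in> T. y \<in> N}" by blast
  qed
  note restrict[OF bij, of "NC n A"]
  moreover have "{P \<in> ?U. edge_image ?z P \<in> NC n A} =
      {P. nctree 0 (int n - 1) P \<and> (\<forall>x\<in>?V. deg P x \<in> A)}"
  proof (intro set_eqI)
    fix P
    have "P \<in> ?U" if "nctree 0 (int n - 1) P"
    proof
      show "P \<subseteq> {(x, y). x \<in> ?V \<and> y \<in> ?V \<and> x < y}"
      proof clarify
        fix x y assume "(x, y) \<in> P"
        from nctreeD(1)[OF that this] show "x \<in> ?V \<and> y \<in> ?V \<and> x < y" by simp
      qed
    qed
    then show "P \<in> {P \<in> ?U. edge_image ?z P \<in> NC n A} \<longleftrightarrow>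
        P \<in> {P. nctree 0 (int n - 1) P \<and> (\<forall>x\<in>?V. deg P x \<in> A)}"
      unfolding mem_Collect_eq using iff[of P] by blast
  qed
  moreover have "{E \<in> {E. \<forall>e\<in>E. e \<subseteq> ?z ` ?V \<and> card e = 2}. E \<in> NC n A} = NC n A"
    unfolding img by (auto simp: NC_def noncrossing_tree_def tree_on_def)
  ultimately show ?thesis by simp
qed

text \<open>Each admissible root degree has weight 1: the root is the left end of the interval, so
  all its children lie on the same side and there is no choice of left and right.\<close>

definition root_fps :: "nat set \<Rightarrow> real fps" where
  "root_fps A = Abs_fps (\<lambda>k. if k \<in> A then 1 else 0)"

lemma card_NC_eq_nth: "real (card (NC (Suc n) A)) = (root_fps A oo butterfly_fps A) $ n"
proof -
  let ?S = "{P. nctree 0 (int n) P \<and> (\<forall>x\<in>{0..int n}. deg P x \<in> A)}"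
  have "?S = (\<Union>i\<in>{i. i \<le> n \<and> i \<in> A}. ltrees A 0 (int n) i)"
  proof (intro set_eqI iffI)
    fix P assume "P \<in> ?S"
    then show "P \<in> (\<Union>i\<in>{i. i \<le> n \<and> i \<in> A}. ltrees A 0 (int n) i)"
      using deg_le[of 0 n P 0] by (auto simp: ltrees_def)
  next
    fix P assume "P \<in> (\<Union>i\<in>{i. i \<le> n \<and> i \<in> A}. ltrees A 0 (int n) i)"
    then have "nctree 0 (int n) P" "deg P 0 \<in> A" "\<And>x. 0 < x \<Longrightarrow> x \<le> int n \<Longrightarrow> deg P x \<in> A"
      by (auto simp: ltrees_def)
    then show "P \<in> ?S" by (auto simp: le_less)
  qed
  then have "card ?S = (\<Sum>i | i \<le> n \<and> i \<in> A. ltree_count A i n)"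
    unfolding ltree_count_def
    by (simp only:) (rule card_UN_disjoint, simp, simp, auto simp: ltrees_def)
  moreover have "card (NC (Suc n) A) = card ?S"
    using bij_betw_same_card[OF bij_betw_NC[of "Suc n" A]] by simp
  ultimately have "real (card (NC (Suc n) A)) = (\<Sum>i | i \<le> n \<and> i \<in> A. (butterfly_fps A ^ i) $ n)"
    by (simp add: ltree_fps_eq_power[symmetric] ltree_fps_def)
  also have "\<dots> = (\<Sum>i=0..n. root_fps A $ i * (butterfly_fps A ^ i) $ n)"
    by (rule sum.mono_neutral_cong_left) (auto simp: root_fps_def)
  finally show ?thesis by (simp add: fps_compose_nth)
qed

text \<open>With \<open>n + 2\<close> vertices there are \<open>n + 1\<close> edges, so Lagrange
  inversion is applied at \<open>Suc n\<close>. The factor \<open>fps_deriv (root_fps A)\<close>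
  raises the power of \<open>offspring_fps A\<close> by one more.\<close>

theorem card_NC_eq:
  assumes "1 \<in> A"
  shows "real (Suc n) * real (card (NC (Suc (Suc n)) A)) = (offspring_fps A ^ Suc (Suc n)) $ n"
proof -
  have "fps_deriv (root_fps A) = offspring_fps A"
    by (rule fps_ext) (simp add: root_fps_def offspring_fps_def)
  moreover have "offspring_fps A $ 0 \<noteq> 0" using assms by (simp add: offspring_fps_def)
  ultimately show ?thesis
    using lagrange_inversion[of "offspring_fps A" "butterfly_fps A" "Suc n" "root_fps A"]
    by (simp add: card_NC_eq_nth butterfly_fps_eq[symmetric])
qed

section \<open>A local limit theorem\<close>

lemma integral_cis_period:
  "(\<integral>x. indicator {-pi..pi} x *\<^sub>R cis (real_of_int j * x) \<partial>lborel) = (if j = 0 then 2 * pi else 0)"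
proof (cases "j = 0")
  case False
  define F where "F x = cis (real_of_int j * x) / (\<i> * of_int j)" for x
  have "((\<lambda>x. cis (c * x)) has_vector_derivative of_real c * (\<i> * cis (c * x))) (at x within S)" for c x S
    unfolding has_vector_derivative_def
    by (rule derivative_eq_intros refl)+ (simp add: fun_eq_iff scaleR_conv_of_real)
  from has_vector_derivative_mult_right[OF this, of "1 / (\<i> * of_int j)" "real_of_int j"]
  have "(F has_vector_derivative cis (real_of_int j * x)) (at x within {-pi..pi})" for x
    using False by (simp add: F_def[abs_def])
  moreover have "continuous_on {-pi..pi} (\<lambda>x. cis (real_of_int j * x))"
    by (intro continuous_intros)
  ultimately have "has_bochner_integral lborel (\<lambda>x. indicator {-pi..pi} x *\<^sub>R cis (real_of_int j * x))
      (F pi - F (- pi))"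
    by (intro has_bochner_integral_FTC_Icc) auto
  moreover have "F pi = F (- pi)"
    by (simp add: F_def complex_eq_iff cis.ctr mult.commute[of _ pi] sin_npi_int)
  ultimately show ?thesis using False by (simp add: has_bochner_integral_integral_eq)
qed (simp add: scaleR_conv_of_real)

text \<open>To be applied to the critical law divided by the gcd of its support. Because of the atom
  at 0, gcd one of the support means that the law sits on no proper sublattice; \<open>r > 1\<close>
  provides exponential moments.\<close>

locale lattice_law =
  fixes a :: "nat \<Rightarrow> real" and r :: real
  assumes a_nonneg: "a j \<ge> 0" and a_sums: "a sums 1" and a_0: "a 0 > 0"
    and r_gt_1: "r > 1" and a_r_summable: "summable (\<lambda>j. a j * r ^ j)"
    and aperiodic: "Gcd {j. a j \<noteq> 0} = 1"
begin

definition mean :: real where "mean = (\<Sum>j. a j * real j)"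

definition var :: real where "var = (\<Sum>j. a j * (real j - mean)\<^sup>2)"

definition gf :: "complex fps" where "gf = Abs_fps (\<lambda>j. complex_of_real (a j))"

text \<open>The characteristic function of the centred law, so that the expansion at 0 has no linear
  term.\<close>

definition chf :: "real \<Rightarrow> complex" where
  "chf t = (\<Sum>j. of_real (a j) * cis ((real j - mean) * t))"

lemma summable_moment: "summable (\<lambda>j. a j * \<bar>real j - m\<bar> ^ p)"
proof -
  have "(\<lambda>j. \<bar>real j - m\<bar> ^ p / r ^ j) \<longlonglongrightarrow> 0"
    using r_gt_1 by real_asymp
  then obtain K where K: "\<bar>real j - m\<bar> ^ p / r ^ j \<le> K" for j
    using convergent_imp_Bseq[of "\<lambda>j. \<bar>real j - m\<bar> ^ p / r ^ j"] unfolding Bseq_def convergent_def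
    by (metis abs_le_D1 real_norm_def)
  have "norm (a j * \<bar>real j - m\<bar> ^ p) \<le> K * (a j * r ^ j)" for j
  proof -
    have "\<bar>real j - m\<bar> ^ p \<le> K * r ^ j"
      using K[of j] r_gt_1 by (simp add: divide_le_eq)
    then have "a j * \<bar>real j - m\<bar> ^ p \<le> a j * (K * r ^ j)"
      using a_nonneg by (intro mult_left_mono)
    then show ?thesis using a_nonneg[of j] by (simp add: abs_mult mult_ac)
  qed
  then show ?thesis
    by (intro summable_comparison_test'[OF summable_mult[OF a_r_summable, of K]])
qed

lemma summable_a: "summable a"
  using a_sums by (rule sums_summable)

lemma suminf_a: "suminf a = 1"
  using a_sums by (simp add: sums_iff)

lemma sums_mean: "(\<lambda>j. a j * real j) sums mean"
  using summable_moment[of 0 1] by (simp add: mean_def summable_sums)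

lemma sums_centered: "(\<lambda>j. a j * (real j - mean)) sums 0"
  using sums_diff[OF sums_mean sums_mult2[OF a_sums, of mean]] by (simp add: algebra_simps)

lemma sums_var: "(\<lambda>j. a j * (real j - mean)\<^sup>2) sums var"
  using summable_moment[of mean 2] by (simp add: var_def summable_sums)

lemma ex_pos: obtains j where "j > 0" "a j > 0"
proof -
  have "\<not> {j. a j \<noteq> 0} \<subseteq> {0}"
    using aperiodic by (metis Gcd_0_iff zero_neq_one)
  then show ?thesis using that a_nonneg by (metis (mono_tags) insertI1 less_eq_real_def
      mem_Collect_eq neq0_conv subsetI)
qed

lemma mean_pos: "mean > 0"
proof -
  obtain j where j: "j > 0" "a j > 0" by (rule ex_pos)
  have "(\<Sum>j. a j * real j) > 0"
    by (rule suminf_pos2[of _ j]) (use sums_mean j a_nonneg in \<open>auto simp: sums_iff\<close>)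
  then show ?thesis by (simp add: mean_def)
qed

lemma var_pos: "var > 0"
  unfolding var_def
  by (rule suminf_pos2[of _ 0]) (use sums_var a_nonneg a_0 mean_pos in \<open>auto simp: sums_iff\<close>)

lemma norm_summable_chf: "summable (\<lambda>j. norm (of_real (a j) * cis (f j)))"
  using summable_a a_nonneg by (simp add: norm_mult)

lemma conv_radius_gf: "fps_conv_radius gf > 1"
proof -
  have "ereal (norm (complex_of_real r)) \<le> fps_conv_radius gf"
    unfolding fps_conv_radius_def
    by (rule conv_radius_geI)
      (use a_r_summable in \<open>simp add: gf_def flip: of_real_power of_real_mult\<close>)
  moreover have "1 < ereal (norm (complex_of_real r))" using r_gt_1 by simp
  ultimately show ?thesis by (rule less_le_trans[rotated])
qed

lemma chf_eq: "chf t = cis (- mean * t) * eval_fps gf (cis t)"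
proof -
  have "chf t = (\<Sum>j. cis (- mean * t) * (of_real (a j) * cis t ^ j))"
    unfolding chf_def
    by (intro suminf_cong) (simp add: Complex.DeMoivre cis_mult algebra_simps)
  also have "\<dots> = cis (- mean * t) * (\<Sum>j. of_real (a j) * cis t ^ j)"
    using norm_summable_chf[of "\<lambda>j. real j * t"]
    by - (subst suminf_mult, rule summable_norm_cancel, simp_all add: Complex.DeMoivre)
  finally show ?thesis by (simp add: eval_fps_def gf_def)
qed

lemma continuous_chf: "continuous_on S chf"
  unfolding chf_eq[abs_def]
  using conv_radius_gf by (intro continuous_intros) (auto simp: one_ereal_def)

lemma norm_chf_le: "norm (chf t) \<le> 1"
  unfolding chf_def using summable_norm[OF norm_summable_chf[of "\<lambda>j. (real j - mean) * t"]]
  by (simp add: norm_mult a_nonneg suminf_a)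

text \<open>Fourier inversion over one period. The radius of convergence exceeds 1, so the series
  converges absolutely on the unit circle and may be integrated term by term; only the frequency
  \<open>m\<close> survives. The factor \<open>cis\<close> also undoes the centring in
  \<open>chf\<close>.\<close>

lemma gf_power_nth:
  "fps_nth (gf ^ n) m = (1 / (2 * pi)) *
     (\<integral>t. indicator {-pi..pi} t *\<^sub>R (chf t ^ n * cis ((real n * mean - real m) * t)) \<partial>lborel)"
proof -
  define c where "c = fps_nth (gf ^ n)"
  define g where "g k t = indicator {-pi..pi} t *\<^sub>R (c k * cis (real_of_int (int k - int m) * t))" for k t
  have rad: "fps_conv_radius (gf ^ n) > 1"
    using conv_radius_gf fps_conv_radius_power[of gf n] by (rule less_le_trans)
  then have sc: "summable (\<lambda>k. norm (c k))"
    using norm_summable_fps[of 1 "gf ^ n"] by (simp add: c_def one_ereal_def)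
  have eq: "indicator {-pi..pi} t *\<^sub>R (chf t ^ n * cis ((real n * mean - real m) * t)) = (\<Sum>k. g k t)" for t
  proof -
    have "chf t ^ n * cis ((real n * mean - real m) * t) = cis (- real m * t) * eval_fps gf (cis t) ^ n"
    proof -
      have "cis (- mean * t) ^ n * cis ((real n * mean - real m) * t) = cis (- real m * t)"
        by (simp add: Complex.DeMoivre cis_mult algebra_simps)
      then show ?thesis by (simp only: chf_eq power_mult_distrib mult_ac)
    qed
    also have "eval_fps gf (cis t) ^ n = eval_fps (gf ^ n) (cis t)"
      using conv_radius_gf by (subst eval_fps_power) (auto simp: one_ereal_def)
    also have "cis (- real m * t) * \<dots> = (\<Sum>k. cis (- real m * t) * (c k * cis t ^ k))"
      unfolding eval_fps_def c_def
      by (rule suminf_mult[symmetric], rule summable_fps) (use rad in \<open>simp add: one_ereal_def\<close>)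
    also have "\<dots> = (\<Sum>k. c k * cis (real_of_int (int k - int m) * t))"
      by (intro suminf_cong) (simp add: Complex.DeMoivre cis_mult algebra_simps)
    finally have "indicator {-pi..pi} t *\<^sub>R (chf t ^ n * cis ((real n * mean - real m) * t)) =
        indicator {-pi..pi} t *\<^sub>R (\<Sum>k. c k * cis (real_of_int (int k - int m) * t))"
      by simp
    also have "\<dots> = (\<Sum>k. g k t)"
      unfolding g_def using sc
      by - (subst suminf_scaleR_right, rule summable_norm_cancel, simp_all add: norm_mult)
    finally show ?thesis .
  qed
  have int_g: "integrable lborel (g k)" for k
    unfolding g_def[abs_def]
    by (rule borel_integrable_compact[of "{-pi..pi}" "\<lambda>t. c k * cis (real_of_int (int k - int m) * t)"])
      (auto intro!: continuous_intros)
  have norm_g: "norm (g k t) = norm (c k) * indicator {-pi..pi} t" for k t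
    by (simp add: g_def norm_mult)
  have "(\<lambda>k. integral\<^sup>L lborel (g k)) sums (\<integral>t. (\<Sum>k. g k t) \<partial>lborel)"
  proof (rule sums_integral[OF int_g])
    show "AE t in lborel. summable (\<lambda>k. norm (g k t))"
      using sc by (simp add: norm_g summable_mult2)
    show "summable (\<lambda>k. \<integral>t. norm (g k t) \<partial>lborel)"
      using sc by (simp add: norm_g summable_mult2)
  qed
  moreover have "integral\<^sup>L lborel (g k) = (if k = m then 2 * pi * c m else 0)" for k
  proof -
    have "integral\<^sup>L lborel (g k) =
        (\<integral>t. c k * (indicator {-pi..pi} t *\<^sub>R cis (real_of_int (int k - int m) * t)) \<partial>lborel)"
      by (simp add: g_def[abs_def])
    also have "\<dots> = (if k = m then 2 * pi * c m else 0)"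
      unfolding integral_mult_right_zero integral_cis_period by simp
    finally show ?thesis .
  qed
  ultimately have "(\<lambda>k. if k = m then 2 * pi * c m else 0) sums (\<integral>t. (\<Sum>k. g k t) \<partial>lborel)" by simp
  moreover have "(\<lambda>k. if k = m then 2 * pi * c m else 0) sums (2 * pi * c m)"
    by (rule sums_single)
  ultimately have "(\<integral>t. (\<Sum>k. g k t) \<partial>lborel) = 2 * pi * c m" by (rule sums_unique2)
  then show ?thesis by (simp add: eq c_def)
qed

text \<open>If \<open>cis (j * t)\<close> were 1 on the whole support, the least positive
  \<open>j\<close> with this property would divide the support, hence be 1, and \<open>t\<close>
  would be a multiple of 2 pi. So some atom \<open>j\<close> points in another direction than the
  atom at 0, and for these two the triangle inequality is strict.\<close>

lemma norm_chf_less: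
  assumes "t \<noteq> 0" "\<bar>t\<bar> \<le> pi"
  shows "norm (chf t) < 1"
proof -
  have "\<exists>j. a j \<noteq> 0 \<and> cis (real j * t) \<noteq> 1"
  proof (rule ccontr)
    assume "\<not> ?thesis"
    then have one: "cis (real j * t) = 1" if "a j \<noteq> 0" for j using that by blast
    define I where "I j \<longleftrightarrow> j > 0 \<and> cis (real j * t) = 1" for j :: nat
    define g where "g = (LEAST j. I j)"
    obtain j where "j > 0" "a j > 0" by (rule ex_pos)
    then have "I j" using one[of j] by (simp add: I_def)
    then have g: "I g" unfolding g_def by (rule LeastI)
    have "g dvd j" if "a j \<noteq> 0" for j
    proof -
      have "cis (real j * t) = cis (real g * t) ^ (j div g) * cis (real (j mod g) * t)"
      proof -
        have "real j = real g * real (j div g) + real (j mod g)"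
          by (metis mult_div_mod_eq of_nat_add of_nat_mult)
        then show ?thesis by (simp add: Complex.DeMoivre cis_mult algebra_simps)
      qed
      then have "cis (real (j mod g) * t) = 1" using one[OF that] g by (simp add: I_def)
      moreover have "\<not> I (j mod g)"
        using g not_less_Least[of "j mod g" I] unfolding g_def[symmetric] by (simp add: I_def)
      ultimately show ?thesis by (simp add: I_def dvd_eq_mod_eq_0)
    qed
    then have "g dvd Gcd {j. a j \<noteq> 0}" by (intro Gcd_greatest) simp
    then have "g = 1" using aperiodic by simp
    then have "cos t = 1" using g by (simp add: I_def complex_eq_iff)
    then obtain k :: int where k: "t = of_int k * 2 * pi" using cos_one_2pi_int by blast
    then have "k \<noteq> 0" using assms by auto
    then have "1 \<le> real_of_int \<bar>k\<bar>" by linarith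
    then have "1 * (2 * pi) \<le> real_of_int \<bar>k\<bar> * (2 * pi)" by (intro mult_right_mono) auto
    then show False using assms(2) k pi_gt_zero by (simp add: abs_mult)
  qed
  then obtain j where j: "a j \<noteq> 0" "cis (real j * t) \<noteq> 1" by blast
  define w where "w = cis (real j * t)"
  have "j \<noteq> 0" using j(2) by (cases j) auto
  have aj: "a j > 0" using j(1) a_nonneg[of j] by simp
  have "Re w < 1"
  proof -
    have "Re w \<le> 1" by (simp add: w_def)
    moreover have "Re w \<noteq> 1"
    proof
      assume "Re w = 1"
      then have "Im w = 0" using sin_cos_squared_add[of "real j * t"] by (simp add: w_def)
      then show False using \<open>Re w = 1\<close> j(2) by (simp add: w_def complex_eq_iff)
    qed
    ultimately show ?thesis by simp
  qed
  have "norm (a 0 + a j * w) < a 0 + a j"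
  proof (rule power2_less_imp_less)
    have "(norm (a 0 + a j * w))\<^sup>2 = (a 0)\<^sup>2 + 2 * a 0 * a j * Re w + (a j)\<^sup>2 * ((Re w)\<^sup>2 + (Im w)\<^sup>2)"
      unfolding cmod_power2 by (simp add: power2_eq_square algebra_simps)
    also have "(Re w)\<^sup>2 + (Im w)\<^sup>2 = 1" by (simp add: w_def)
    also have "(a 0)\<^sup>2 + 2 * a 0 * a j * Re w + (a j)\<^sup>2 * 1 < (a 0)\<^sup>2 + 2 * a 0 * a j * 1 + (a j)\<^sup>2 * 1"
      using \<open>Re w < 1\<close> a_0 aj by (intro add_strict_right_mono add_strict_left_mono mult_strict_left_mono) auto
    also have "\<dots> = (a 0 + a j)\<^sup>2" by (simp add: power2_eq_square algebra_simps)
    finally show "(norm (a 0 + a j * w))\<^sup>2 < (a 0 + a j)\<^sup>2" .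
  qed (use a_0 aj in simp)
  \<comment> \<open>The remaining atoms, to which the plain triangle inequality is applied.\<close>
  define b where "b k = (if k \<in> {0, j} then 0 else a k)" for k
  have "(\<lambda>k. if k \<in> {0, j} then a k else 0) sums (\<Sum>k\<in>{0, j}. a k)"
    by (rule sums_If_finite_set) simp
  from sums_diff[OF a_sums this] have b_sums: "b sums (1 - (a 0 + a j))"
    using \<open>j \<noteq> 0\<close> by (simp add: b_def[abs_def] if_distrib cong: if_cong)
  have b_nonneg: "b k \<ge> 0" for k using a_nonneg by (simp add: b_def)
  have sb: "summable (\<lambda>k. norm (of_real (b k) * cis (real k * t)))"
    using b_sums b_nonneg by (simp add: norm_mult sums_iff)
  have "(\<lambda>k. if k \<in> {0, j} then of_real (a k) * cis (real k * t) else 0) sums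
      (\<Sum>k\<in>{0, j}. of_real (a k) * cis (real k * t))"
    by (rule sums_If_finite_set) simp
  note sums_add[OF this summable_sums[OF summable_norm_cancel[OF sb]]]
  moreover have "(if k \<in> {0, j} then of_real (a k) * cis (real k * t) else 0) +
      of_real (b k) * cis (real k * t) = of_real (a k) * cis (real k * t)" for k
    by (simp add: b_def)
  moreover have "(\<Sum>k\<in>{0, j}. of_real (a k) * cis (real k * t)) = a 0 + a j * w"
    using \<open>j \<noteq> 0\<close> by (simp add: w_def)
  ultimately have "(\<lambda>k. of_real (a k) * cis (real k * t)) sums
      ((a 0 + a j * w) + (\<Sum>k. of_real (b k) * cis (real k * t)))"
    by (simp only:)
  then have "eval_fps gf (cis t) = (a 0 + a j * w) + (\<Sum>k. of_real (b k) * cis (real k * t))"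
    by (simp add: eval_fps_def gf_def Complex.DeMoivre sums_iff)
  then have "norm (chf t) \<le> norm (a 0 + a j * w) + norm (\<Sum>k. of_real (b k) * cis (real k * t))"
    by (simp add: chf_eq norm_mult norm_triangle_ineq)
  also have "norm (\<Sum>k. of_real (b k) * cis (real k * t)) \<le> (\<Sum>k. norm (of_real (b k) * cis (real k * t)))"
    by (rule summable_norm[OF sb])
  also have "\<dots> = 1 - (a 0 + a j)"
    using b_sums b_nonneg by (simp add: norm_mult sums_iff)
  finally show ?thesis using \<open>norm (a 0 + a j * w) < a 0 + a j\<close> by simp
qed

lemma gf_power_of_real: "fps_nth (gf ^ n) m = complex_of_real (fps_nth (Abs_fps a ^ n) m)"
proof (induction n arbitrary: m)
  case (Suc n)
  then show ?case by (simp add: fps_mult_nth gf_def)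
qed simp

text \<open>Second-order Taylor expansion of each \<open>cis\<close> term. Averaging against
  \<open>a\<close> kills the linear term by centring, and the remainders add up to the third
  absolute central moment over 6, which is \<open>C\<close>.\<close>

lemma chf_expansion:
  obtains C where "C \<ge> 0" "\<And>t. norm (chf t - (1 - var * t\<^sup>2 / 2)) \<le> C * \<bar>t\<bar> ^ 3"
proof
  define C where "C = (\<Sum>j. a j * \<bar>real j - mean\<bar> ^ 3) / 6"
  show "C \<ge> 0"
    unfolding C_def using summable_moment[of mean 3] a_nonneg by (simp add: suminf_nonneg)
  fix t
  define e where "e j = cis ((real j - mean) * t) -
      (1 + \<i> * of_real ((real j - mean) * t) - of_real (((real j - mean) * t)\<^sup>2 / 2))" for j
  have e: "norm (e j) \<le> \<bar>(real j - mean) * t\<bar> ^ 3 / 6" for j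
  proof -
    have sum: "(\<Sum>k\<le>2. (\<i> * of_real y) ^ k / fact k) = 1 + \<i> * of_real y - of_real (y\<^sup>2 / 2)" for y
      by (simp add: eval_nat_numeral) (simp add: complex_eq_iff)
    have "norm (e j) \<le> \<bar>(real j - mean) * t\<bar> ^ Suc 2 / fact (Suc 2)"
      using iexp_approx1[of "(real j - mean) * t" 2] by (simp only: sum cis_conv_exp e_def)
    moreover have "fact (Suc 2) = (6 :: real)" by (simp add: fact_numeral eval_nat_numeral)
    moreover have "Suc 2 = 3" by simp
    ultimately show ?thesis by (simp only:)
  qed
  have "(\<lambda>j. of_real (a j) * cis ((real j - mean) * t)) sums chf t"
    unfolding chf_def by (rule summable_sums, rule summable_norm_cancel, rule norm_summable_chf)
  moreover have "(\<lambda>j. of_real (a j) * (1 + \<i> * of_real ((real j - mean) * t) -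
      of_real (((real j - mean) * t)\<^sup>2 / 2))) sums (1 - var * t\<^sup>2 / 2)"
  proof -
    have 1: "(\<lambda>j. complex_of_real (a j)) sums 1"
      using sums_of_real[OF a_sums, where 'a = complex] by simp
    have 2: "(\<lambda>j. complex_of_real (a j * (real j - mean)) * (\<i> * of_real t)) sums 0"
      using sums_mult2[OF sums_of_real[OF sums_centered, where 'a = complex], of "\<i> * of_real t"] by simp
    have 3: "(\<lambda>j. complex_of_real (a j * (real j - mean)\<^sup>2) * of_real (t\<^sup>2 / 2)) sums (var * t\<^sup>2 / 2)"
      using sums_mult2[OF sums_of_real[OF sums_var, where 'a = complex], of "of_real (t\<^sup>2 / 2)"] by simp
    have "of_real A * (1 + \<i> * of_real (y * t) - of_real ((y * t)\<^sup>2 / 2)) =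
        of_real A + of_real (A * y) * (\<i> * of_real t) - complex_of_real (A * y\<^sup>2) * of_real (t\<^sup>2 / 2)" for A y
      by (simp add: algebra_simps power_mult_distrib)
    with sums_diff[OF sums_add[OF 1 2] 3] show ?thesis by (simp only: add_0_right of_real_diff of_real_1)
  qed
  ultimately have "(\<lambda>j. of_real (a j) * e j) sums (chf t - (1 - var * t\<^sup>2 / 2))"
    unfolding e_def right_diff_distrib by (rule sums_diff)
  then have eq: "chf t - (1 - var * t\<^sup>2 / 2) = (\<Sum>j. of_real (a j) * e j)" by (simp add: sums_iff)
  have le: "norm (of_real (a j) * e j) \<le> (a j * \<bar>real j - mean\<bar> ^ 3) * (\<bar>t\<bar> ^ 3 / 6)" for j
    using mult_left_mono[OF e[of j] a_nonneg[of j]] a_nonneg[of j]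
    by (simp add: norm_mult abs_mult power_mult_distrib mult_ac)
  have "norm (\<Sum>j. of_real (a j) * e j) \<le> (\<Sum>j. (a j * \<bar>real j - mean\<bar> ^ 3) * (\<bar>t\<bar> ^ 3 / 6))"
    by (rule norm_suminf_le[OF le summable_mult2[OF summable_moment]])
  also have "\<dots> = C * \<bar>t\<bar> ^ 3"
    using suminf_mult2[OF summable_moment[of mean 3], of "\<bar>t\<bar> ^ 3 / 6"] by (simp add: C_def)
  finally show "norm (chf t - (1 - var * t\<^sup>2 / 2)) \<le> C * \<bar>t\<bar> ^ 3" by (simp only: eq)
qed

text \<open>Near 0 the quadratic term dominates; away from 0 compactness and
  \<open>norm_chf_less\<close> bound the norm away from 1. The lemma provides the integrable
  majorant for the limit theorem: for \<open>t = x / sqrt n\<close> the \<open>n\<close>-th power of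
  the bound does not depend on \<open>n\<close>.\<close>

lemma chf_gaussian_bound:
  obtains c where "c > 0" "\<And>t. \<bar>t\<bar> \<le> pi \<Longrightarrow> norm (chf t) \<le> exp (- c * t\<^sup>2)"
proof -
  obtain C where C: "C \<ge> 0" "\<And>t. norm (chf t - (1 - var * t\<^sup>2 / 2)) \<le> C * \<bar>t\<bar> ^ 3"
    by (rule chf_expansion) blast
  \<comment> \<open>The first entry keeps \<open>1 - var * t\<^sup>2 / 2\<close> nonnegative; the
    second makes the cubic error at most half of the quadratic term, with \<open>C + 1\<close> in
    place of \<open>C\<close> to avoid dividing by zero.\<close>
  define \<delta> where "\<delta> = min (sqrt (2 / var)) (var / (4 * (C + 1)))"
  have "\<delta> > 0" using var_pos C(1) by (simp add: \<delta>_def)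
  have near: "norm (chf t) \<le> 1 - var / 4 * t\<^sup>2" if "\<bar>t\<bar> \<le> \<delta>" for t
  proof -
    have "\<bar>t\<bar> \<le> sqrt (2 / var)" using that by (simp add: \<delta>_def)
    then have "t\<^sup>2 \<le> 2 / var" using real_le_rsqrt sqrt_le_D real_sqrt_abs by (metis real_sqrt_le_iff)
    then have 1: "var * t\<^sup>2 / 2 \<le> 1" using var_pos by (simp add: field_simps)
    have "C * \<bar>t\<bar> \<le> (C + 1) * (var / (4 * (C + 1)))"
      using that C(1) var_pos by (intro mult_mono) (auto simp: \<delta>_def)
    also have "\<dots> = var / 4" using C(1) by (simp add: field_simps)
    finally have "C * \<bar>t\<bar> * t\<^sup>2 \<le> var / 4 * t\<^sup>2" by (intro mult_right_mono) auto
    then have 2: "C * \<bar>t\<bar> ^ 3 \<le> var / 4 * t\<^sup>2"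
      by (simp add: power3_eq_cube power2_eq_square)
    have "norm (chf t) \<le> norm (complex_of_real (1 - var * t\<^sup>2 / 2)) + norm (chf t - (1 - var * t\<^sup>2 / 2))"
      using norm_triangle_ineq[of "complex_of_real (1 - var * t\<^sup>2 / 2)" "chf t - (1 - var * t\<^sup>2 / 2)"] by simp
    also have "norm (complex_of_real (1 - var * t\<^sup>2 / 2)) = 1 - var * t\<^sup>2 / 2"
      unfolding norm_of_real using 1 by simp
    finally show ?thesis using C(2)[of t] 2 by simp
  qed
  define K where "K = {-pi..-\<delta>} \<union> {\<delta>..pi}"
  have "compact K" by (simp add: K_def compact_Un)
  have "\<exists>\<rho><1. \<forall>t\<in>K. norm (chf t) \<le> \<rho>"
  proof (cases "K = {}")
    case False
    obtain s where s: "s \<in> K" "\<And>t. t \<in> K \<Longrightarrow> norm (chf t) \<le> norm (chf s)"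
      using continuous_attains_sup[OF \<open>compact K\<close> False, of "\<lambda>t. norm (chf t)"]
        continuous_on_norm[OF continuous_chf] by blast
    have "norm (chf s) < 1" using s(1) \<open>\<delta> > 0\<close> by (intro norm_chf_less) (auto simp: K_def)
    then show ?thesis using s(2) by blast
  qed (auto intro: exI[of _ 0])
  then obtain \<rho> where \<rho>: "\<rho> < 1" "\<And>t. t \<in> K \<Longrightarrow> norm (chf t) \<le> \<rho>" by blast
  \<comment> \<open>Chosen so that \<open>1 - c * t\<^sup>2\<close> bounds the norm in both regions:
    the first entry near 0, the second on \<open>K\<close>, where
    \<open>t\<^sup>2 \<le> pi\<^sup>2\<close>.\<close>
  define c where "c = min (var / 4) ((1 - \<rho>) / pi\<^sup>2)"
  have "c > 0" using var_pos \<rho>(1) by (simp add: c_def)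
  moreover have "norm (chf t) \<le> exp (- c * t\<^sup>2)" if "\<bar>t\<bar> \<le> pi" for t
  proof -
    have "norm (chf t) \<le> 1 - c * t\<^sup>2"
    proof (cases "\<bar>t\<bar> \<le> \<delta>")
      case True
      have "c * t\<^sup>2 \<le> var / 4 * t\<^sup>2" unfolding c_def by (intro mult_right_mono min.cobounded1) simp
      then show ?thesis using near[OF True] by simp
    next
      case False
      then have "t \<in> K" using that by (auto simp: K_def)
      have "t\<^sup>2 \<le> pi\<^sup>2" using that by (simp add: abs_le_square_iff flip: abs_le_square_iff)
      have "c * t\<^sup>2 \<le> (1 - \<rho>) / pi\<^sup>2 * pi\<^sup>2"
        using \<rho>(1) \<open>t\<^sup>2 \<le> pi\<^sup>2\<close> \<open>c > 0\<close> by (intro mult_mono) (auto simp: c_def)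
      then show ?thesis using \<rho>(2)[OF \<open>t \<in> K\<close>] by simp
    qed
    also have "\<dots> \<le> exp (- c * t\<^sup>2)" using exp_ge_add_one_self[of "- c * t\<^sup>2"] by simp
    finally show ?thesis .
  qed
  ultimately show ?thesis by (rule that)
qed

text \<open>Comparison with \<open>(1 + y / n) ^ n\<close>: in the closed unit disk
  \<open>n\<close>-th powers differ by at most \<open>n\<close> times the difference of the bases,
  here \<open>n\<close> times a cubic error of order \<open>n powr (-3/2)\<close>.\<close>

lemma chf_power_tendsto:
  "(\<lambda>n. chf (x / sqrt n) ^ n) \<longlonglongrightarrow> exp (- var * x\<^sup>2 / 2)"
proof -
  obtain C where C: "C \<ge> 0" "\<And>t. norm (chf t - (1 - var * t\<^sup>2 / 2)) \<le> C * \<bar>t\<bar> ^ 3"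
    by (rule chf_expansion) blast
  define y where "y = - var * x\<^sup>2 / 2"
  have "\<forall>\<^sub>F n in sequentially. norm (chf (x / sqrt n) ^ n - complex_of_real ((1 + y / n) ^ n)) \<le> C * \<bar>x\<bar> ^ 3 / sqrt n"
  proof (rule eventually_sequentiallyI)
    \<comment> \<open>As \<open>y \<le> 0\<close>, so large an \<open>n\<close> places
      \<open>1 + y / n\<close> between 0 and 1.\<close>
    fix n :: nat assume n: "n \<ge> Suc (nat \<lceil>\<bar>y\<bar>\<rceil>)"
    then have n0: "real n > 0" and "\<bar>y\<bar> \<le> real n" by linarith+
    then have "\<bar>y / n\<bar> \<le> 1" by simp
    moreover have "y \<le> 0" using var_pos by (simp add: y_def)
    ultimately have ny: "norm (complex_of_real (1 + y / n)) \<le> 1"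
      unfolding norm_of_real using n0 by (auto simp: abs_le_iff field_simps)
    have "norm (chf (x / sqrt n) ^ n - complex_of_real (1 + y / n) ^ n)
        \<le> n * norm (chf (x / sqrt n) - complex_of_real (1 + y / n))"
      by (rule norm_power_diff[OF norm_chf_le ny])
    also have "\<dots> \<le> n * (C * \<bar>x / sqrt n\<bar> ^ 3)"
    proof (rule mult_left_mono)
      have "1 + y / n = 1 - var * (x / sqrt n)\<^sup>2 / 2"
        using n0 by (simp add: y_def power_divide field_simps)
      then show "norm (chf (x / sqrt n) - complex_of_real (1 + y / n)) \<le> C * \<bar>x / sqrt n\<bar> ^ 3"
        using C(2)[of "x / sqrt n"] by simp
    qed simp
    also have "\<dots> = C * \<bar>x\<bar> ^ 3 / sqrt n"
    proof -
      have "real n = sqrt n * sqrt n" using n0 by simp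
      then have "real n / sqrt n ^ 3 = 1 / sqrt n"
        using n0 by (simp add: power3_eq_cube field_simps)
      moreover have "n * (C * \<bar>x / sqrt n\<bar> ^ 3) = (real n / sqrt n ^ 3) * (C * \<bar>x\<bar> ^ 3)"
        by (simp add: power_divide)
      ultimately show ?thesis by simp
    qed
    finally show "norm (chf (x / sqrt n) ^ n - complex_of_real ((1 + y / n) ^ n)) \<le> C * \<bar>x\<bar> ^ 3 / sqrt n"
      by simp
  qed
  moreover have "(\<lambda>n. C * \<bar>x\<bar> ^ 3 / sqrt (real n)) \<longlonglongrightarrow> 0"
    by real_asymp
  ultimately have "(\<lambda>n. chf (x / sqrt n) ^ n - complex_of_real ((1 + y / n) ^ n)) \<longlonglongrightarrow> 0"
    by (rule Lim_null_comparison)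
  moreover have "(\<lambda>n. complex_of_real ((1 + y / n) ^ n)) \<longlonglongrightarrow> complex_of_real (exp y)"
    by (intro tendsto_of_real tendsto_exp_limit_sequentially)
  ultimately show ?thesis unfolding y_def exp_of_real by (rule Lim_transform[rotated])
qed

lemma gaussian_integral:
  assumes "s > 0"
  shows "integrable lborel (\<lambda>x. exp (- s * x\<^sup>2 / 2))"
    and "(\<integral>x. exp (- s * x\<^sup>2 / 2) \<partial>lborel) = sqrt (2 * pi / s)"
proof -
  have s: "sqrt (1 / s) > 0" using assms by simp
  have eq: "(\<lambda>x. exp (- s * x\<^sup>2 / 2)) = (\<lambda>x. sqrt (2 * pi / s) * normal_density 0 (sqrt (1 / s)) x)"
    using assms by (simp add: normal_density_def fun_eq_iff field_simps)
  show "integrable lborel (\<lambda>x. exp (- s * x\<^sup>2 / 2))" unfolding eq using s by simp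
  show "(\<integral>x. exp (- s * x\<^sup>2 / 2) \<partial>lborel) = sqrt (2 * pi / s)"
    unfolding eq using s by simp
qed

text \<open>The substitution \<open>t = x / sqrt n\<close> in \<open>gf_power_nth\<close> brings out
  the factor \<open>sqrt n\<close>, and dominated convergence gives a Gaussian integral. Since
  \<open>M k\<close> keeps the fixed offset \<open>d\<close> from the mean, the phase tends to 1 and
  the limit is the normal density at its centre.\<close>

theorem local_limit:
  fixes N M :: "nat \<Rightarrow> nat" and d :: real
  assumes N: "filterlim N at_top sequentially" and M: "\<And>k. real (M k) = real (N k) * mean + d"
  shows "(\<lambda>k. sqrt (N k) * fps_nth (Abs_fps a ^ N k) (M k)) \<longlonglongrightarrow> 1 / sqrt (2 * pi * var)"
proof -
  define g where "g n x = indicator {-pi..pi} (x / sqrt n) *\<^sub>R (chf (x / sqrt n) ^ n * cis (- d * (x / sqrt n)))"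
    for n :: nat and x :: real
  obtain c where c: "c > 0" "\<And>t. \<bar>t\<bar> \<le> pi \<Longrightarrow> norm (chf t) \<le> exp (- c * t\<^sup>2)"
    by (rule chf_gaussian_bound) blast
  have chf_meas [measurable]: "chf \<in> borel_measurable borel"
    by (rule borel_measurable_continuous_onI[OF continuous_chf])
  have cis_meas [measurable]: "cis \<in> borel_measurable borel"
    by (intro borel_measurable_continuous_onI continuous_intros)
  have ind: "indicator {-pi..pi} y = (if \<bar>y\<bar> \<le> pi then 1 else 0 :: real)" for y :: real
    by (auto simp: indicator_def abs_le_iff)
  have g_lim: "(\<lambda>n. g n x) \<longlonglongrightarrow> complex_of_real (exp (- var * x\<^sup>2 / 2))" for x
  proof -
    have x0: "(\<lambda>n. x / sqrt (real n)) \<longlonglongrightarrow> 0" by real_asymp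
    then have "(\<lambda>n. cis (- d * (x / sqrt (real n)))) \<longlonglongrightarrow> cis (- d * 0)"
      by (intro tendsto_intros)
    from tendsto_mult[OF chf_power_tendsto this]
    have "(\<lambda>n. chf (x / sqrt n) ^ n * cis (- d * (x / sqrt n))) \<longlonglongrightarrow> complex_of_real (exp (- var * x\<^sup>2 / 2))"
      by (simp add: exp_of_real)
    moreover have "\<forall>\<^sub>F n in sequentially. chf (x / sqrt n) ^ n * cis (- d * (x / sqrt n)) = g n x"
    proof -
      have "\<forall>\<^sub>F n in sequentially. dist (x / sqrt (real n)) 0 < pi"
        using x0 by (rule tendstoD) simp
      then show ?thesis
      proof eventually_elim
        case (elim n)
        then have "\<bar>x / sqrt (real n)\<bar> < pi" by (simp only: dist_real_def diff_0_right)
        then have "indicator {-pi..pi} (x / sqrt (real n)) = (1 :: real)"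
          by (simp only: ind less_imp_le if_True)
        then show ?case by (simp only: g_def scaleR_one)
      qed
    qed
    ultimately show ?thesis by (rule Lim_transform_eventually)
  qed
  \<comment> \<open>The index is shifted because \<open>g 0\<close> is constantly 1, division by
    \<open>sqrt 0\<close> giving 0, and so has no integrable majorant.\<close>
  have "(\<lambda>n. integral\<^sup>L lborel (g (Suc n))) \<longlonglongrightarrow> (\<integral>x. complex_of_real (exp (- var * x\<^sup>2 / 2)) \<partial>lborel)"
  proof (rule integral_dominated_convergence)
    show "integrable lborel (\<lambda>x. exp (- (2 * c) * x\<^sup>2 / 2))"
      using c(1) by (intro gaussian_integral) simp
    show "AE x in lborel. (\<lambda>n. g (Suc n) x) \<longlonglongrightarrow> complex_of_real (exp (- var * x\<^sup>2 / 2))"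
      using LIMSEQ_Suc[OF g_lim] by simp
    show "AE x in lborel. norm (g (Suc n) x) \<le> exp (- (2 * c) * x\<^sup>2 / 2)" for n
    proof (rule AE_I2)
      fix x :: real
      let ?t = "x / sqrt (real (Suc n))"
      show "norm (g (Suc n) x) \<le> exp (- (2 * c) * x\<^sup>2 / 2)"
      proof (cases "\<bar>?t\<bar> \<le> pi")
        case True
        then have "indicator {-pi..pi} ?t = (1 :: real)" by (simp only: ind if_True)
        then have "norm (g (Suc n) x) = norm (chf ?t) ^ Suc n"
          by (simp only: g_def scaleR_one norm_mult norm_power norm_cis mult_1_right)
        also have "\<dots> \<le> exp (- c * ?t\<^sup>2) ^ Suc n" by (intro power_mono c(2) True) simp
        also have "\<dots> = exp (- (2 * c) * x\<^sup>2 / 2)"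
          unfolding exp_of_nat_mult[symmetric] by (simp add: power_divide field_simps)
        finally show ?thesis .
      next
        case False
        then have "indicator {-pi..pi} ?t = (0 :: real)" by (simp only: ind if_False)
        then have "g (Suc n) x = 0" by (simp only: g_def scaleR_zero_left)
        then show ?thesis by simp
      qed
    qed
    show "g (Suc n) \<in> borel_measurable lborel" for n
      unfolding g_def[abs_def] by measurable
  qed simp
  then have lim: "(\<lambda>n. integral\<^sup>L lborel (g n)) \<longlonglongrightarrow> (\<integral>x. complex_of_real (exp (- var * x\<^sup>2 / 2)) \<partial>lborel)"
    by (rule LIMSEQ_imp_Suc)
  have "(\<integral>x. complex_of_real (exp (- var * x\<^sup>2 / 2)) \<partial>lborel) = complex_of_real (sqrt (2 * pi / var))"
    using gaussian_integral(2)[OF var_pos] by (simp only: integral_complex_of_real)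
  with lim have "(\<lambda>n. integral\<^sup>L lborel (g n)) \<longlonglongrightarrow> complex_of_real (sqrt (2 * pi / var))" by simp
  from filterlim_compose[OF this N]
  have "(\<lambda>k. 1 / (2 * pi) * integral\<^sup>L lborel (g (N k))) \<longlonglongrightarrow> 1 / (2 * pi) * complex_of_real (sqrt (2 * pi / var))"
    by (rule tendsto_mult_left)
  moreover have "\<forall>\<^sub>F k in sequentially. 1 / (2 * pi) * integral\<^sup>L lborel (g (N k)) =
      complex_of_real (sqrt (N k) * fps_nth (Abs_fps a ^ N k) (M k))"
  proof -
    have "\<forall>\<^sub>F k in sequentially. N k > 0"
      using eventually_compose_filterlim[OF eventually_gt_at_top[of 0] N] .
    then show ?thesis
    proof eventually_elim
      fix k assume "N k > 0"
      define f where "f t = indicator {-pi..pi} t *\<^sub>R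
          (chf t ^ N k * cis ((real (N k) * mean - real (M k)) * t))" for t
      have "integral\<^sup>L lborel f = (1 / sqrt (N k)) *\<^sub>R integral\<^sup>L lborel (g (N k))"
        using lborel_integral_real_affine[of "1 / sqrt (N k)" f 0] \<open>N k > 0\<close> M[of k]
        by (simp add: f_def[abs_def] g_def[abs_def])
      then have "integral\<^sup>L lborel (g (N k)) = sqrt (N k) *\<^sub>R integral\<^sup>L lborel f"
        using \<open>N k > 0\<close> by simp
      also have "integral\<^sup>L lborel f = 2 * pi * fps_nth (gf ^ N k) (M k)"
        using gf_power_nth[of "N k" "M k"] by (simp add: f_def[abs_def])
      also have "fps_nth (gf ^ N k) (M k) = complex_of_real (fps_nth (Abs_fps a ^ N k) (M k))"
        by (rule gf_power_of_real)
      finally show "1 / (2 * pi) * integral\<^sup>L lborel (g (N k)) =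
          complex_of_real (sqrt (N k) * fps_nth (Abs_fps a ^ N k) (M k))"
        by (simp add: scaleR_conv_of_real)
    qed
  qed
  ultimately have "(\<lambda>k. complex_of_real (sqrt (N k) * fps_nth (Abs_fps a ^ N k) (M k))) \<longlonglongrightarrow>
      1 / (2 * pi) * complex_of_real (sqrt (2 * pi / var))"
    by (rule Lim_transform_eventually)
  moreover have "1 / (2 * pi) * complex_of_real (sqrt (2 * pi / var)) = complex_of_real (1 / sqrt (2 * pi * var))"
  proof -
    have "sqrt (2 * pi) * sqrt (2 * pi) = 2 * pi" by simp
    then have "1 / (2 * pi) * sqrt (2 * pi / var) = 1 / sqrt (2 * pi * var)"
      using var_pos by (simp add: real_sqrt_divide real_sqrt_mult field_simps)
    then show ?thesis by (metis of_real_1 of_real_divide of_real_mult of_real_numeral)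
  qed
  ultimately show ?thesis by (simp only: tendsto_of_real_iff)
qed

end

section \<open>Asymptotics\<close>

lemma finite_NC: "finite (NC n A)"
proof (cases "n = 0")
  case True
  then show ?thesis by (simp add: NC_def noncrossing_tree_def)
next
  case False
  have "finite {P. nctree 0 (int n - 1) P \<and> (\<forall>x\<in>{0..int n - 1}. deg P x \<in> A)}"
    by (rule finite_subset[OF _ finite_nctrees]) auto
  then show ?thesis using bij_betw_finite[OF bij_betw_NC[of n A]] False by simp
qed

text \<open>The constants of the theorem are unordered sums over subsets, while the law is handled
  by ordered series padded with zeros.\<close>

lemma infsum_eq_suminf:
  fixes f :: "nat \<Rightarrow> real"
  assumes "summable (\<lambda>k. \<bar>if k \<in> B then f k else 0\<bar>)"
  shows "infsum f B = (\<Sum>k. if k \<in> B then f k else 0)"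
proof -
  have "infsum f B = infsum (\<lambda>k. if k \<in> B then f k else 0) UNIV"
    by (rule infsum_cong_neutral) auto
  also have "\<dots> = (\<Sum>k. if k \<in> B then f k else 0)"
    using assms summable_sums[OF summable_rabs_cancel[OF assms]]
    by (intro infsumI norm_summable_imp_has_sum) simp_all
  finally show ?thesis .
qed

lemma has_sum_imp_sums_indicator:
  fixes f :: "nat \<Rightarrow> real"
  assumes "(f has_sum S) B"
  shows "(\<lambda>k. if k \<in> B then f k else 0) sums S"
proof -
  have "((\<lambda>k. if k \<in> B then f k else 0) has_sum S) UNIV \<longleftrightarrow> (f has_sum S) B"
    by (rule has_sum_cong_neutral) auto
  then show ?thesis using assms by (intro has_sum_imp_sums) simp
qed

lemma gcd_offspring_dvd:
  assumes "(offspring_fps A ^ n) $ k \<noteq> 0"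
  shows "Gcd ((\<lambda>a. a - 1) ` A) dvd k"
  using assms
proof (induction n arbitrary: k)
  case (Suc n)
  then have "(\<Sum>i=0..k. offspring_fps A $ i * (offspring_fps A ^ n) $ (k - i)) \<noteq> 0"
    by (simp add: fps_mult_nth)
  then obtain i where "i \<in> {0..k}" "offspring_fps A $ i * (offspring_fps A ^ n) $ (k - i) \<noteq> 0"
    by (rule sum.not_neutral_contains_not_neutral)
  then have i: "i \<le> k" "offspring_fps A $ i \<noteq> 0" "(offspring_fps A ^ n) $ (k - i) \<noteq> 0" by simp_all
  have "Suc i \<in> A" using i(2) by (simp add: offspring_fps_def split: if_splits)
  then have "i \<in> (\<lambda>a. a - 1) ` A" by (rule rev_image_eqI) simp
  then have "Gcd ((\<lambda>a. a - 1) ` A) dvd i" by (rule Gcd_dvd)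
  then have "Gcd ((\<lambda>a. a - 1) ` A) dvd i + (k - i)" using Suc.IH[OF i(3)] by (rule dvd_add)
  then show ?case using i(1) by simp
qed (auto split: if_splits)

text \<open>Weighting coefficients by powers of \<open>b\<close> is compatible with convolution, and
  so is keeping every \<open>d\<close>-th coefficient when the others vanish. Powers of
  \<open>f\<close> can thus be read off the law of the quotient by \<open>d\<close>.\<close>

lemma fps_power_nth_compress:
  fixes f :: "real fps"
  assumes d: "d > 0" and f: "\<And>k. f $ k \<noteq> 0 \<Longrightarrow> d dvd k"
  shows "(f ^ n) $ (d * m) * b ^ (d * m) = (Abs_fps (\<lambda>j. f $ (d * j) * b ^ (d * j)) ^ n) $ m"
proof (induction n arbitrary: m)
  case 0
  then show ?case using d by simp
next
  case (Suc n)
  have "(f ^ Suc n) $ (d * m) = (\<Sum>i=0..d * m. f $ i * (f ^ n) $ (d * m - i))"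
    by (simp add: fps_mult_nth)
  also have "\<dots> = (\<Sum>i\<in>(\<lambda>j. d * j) ` {0..m}. f $ i * (f ^ n) $ (d * m - i))"
  proof (rule sum.mono_neutral_right)
    show "\<forall>i\<in>{0..d * m} - (\<lambda>j. d * j) ` {0..m}. f $ i * (f ^ n) $ (d * m - i) = 0"
    proof
      fix i assume i: "i \<in> {0..d * m} - (\<lambda>j. d * j) ` {0..m}"
      have "\<not> d dvd i"
      proof
        assume "d dvd i"
        then obtain j where "i = d * j" by (rule dvdE)
        then show False using i d by auto
      qed
      then show "f $ i * (f ^ n) $ (d * m - i) = 0" using f by auto
    qed
  qed (use d in auto)
  also have "\<dots> = (\<Sum>j=0..m. f $ (d * j) * (f ^ n) $ (d * m - d * j))"
    using d by (subst sum.reindex) (auto simp: inj_on_def)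
  finally have "(f ^ Suc n) $ (d * m) * b ^ (d * m) =
      (\<Sum>j=0..m. f $ (d * j) * (f ^ n) $ (d * m - d * j) * b ^ (d * m))"
    by (simp add: sum_distrib_right)
  also have "\<dots> = (\<Sum>j=0..m. (f $ (d * j) * b ^ (d * j)) * ((f ^ n) $ (d * (m - j)) * b ^ (d * (m - j))))"
  proof (rule sum.cong[OF refl])
    fix j assume "j \<in> {0..m}"
    then have "b ^ (d * m) = b ^ (d * j) * b ^ (d * (m - j))"
      by (simp add: diff_mult_distrib2 flip: power_add)
    then show "f $ (d * j) * (f ^ n) $ (d * m - d * j) * b ^ (d * m) =
        (f $ (d * j) * b ^ (d * j)) * ((f ^ n) $ (d * (m - j)) * b ^ (d * (m - j)))"
      by (simp add: diff_mult_distrib2)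
  qed
  also have "\<dots> = (Abs_fps (\<lambda>j. f $ (d * j) * b ^ (d * j)) ^ Suc n) $ m"
    by (simp add: Suc fps_mult_nth)
  finally show ?case .
qed

lemma fps_power_cmult_nth: "(Abs_fps (\<lambda>j. f j / c) ^ n) $ m = (Abs_fps f ^ n) $ m / (c :: real) ^ n"
proof (induction n arbitrary: m)
  case (Suc n)
  then show ?case by (simp add: fps_mult_nth sum_divide_distrib)
qed simp

text \<open>The hypothesis only gives convergence at \<open>b\<close> itself. For infinite
  \<open>A\<close> the terms tend to 0, which forces \<open>b < 1\<close>, whereas the series with
  coefficients at most \<open>k + 1\<close> converges at every nonnegative point below 1;
  \<open>sqrt b\<close> is such a point beyond \<open>b\<close>.\<close>

lemma ex_larger_radius:
  fixes A :: "nat set" and b :: real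
  assumes b: "b > 0" and sums0: "(\<lambda>k. if k + 1 \<in> A then (real k + 1) * (real k - 1) * b ^ k else 0) sums s"
  obtains \<rho> where "\<rho> > 1" "summable (\<lambda>k. (offspring_fps A $ k) * (b * \<rho>) ^ k)"
proof (cases "finite A")
  case True
  have "finite {k. Suc k \<in> A}"
    using finite_vimageI[OF True, of Suc] by (simp add: vimage_def)
  then have "summable (\<lambda>k. (offspring_fps A $ k) * (b * 2) ^ k)"
    by (rule summable_finite) (simp add: offspring_fps_def)
  then show ?thesis using that[of 2] by simp
next
  case False
  have lim: "(\<lambda>k. if k + 1 \<in> A then (real k + 1) * (real k - 1) * b ^ k else 0) \<longlonglongrightarrow> 0"
    using sums0 by (intro summable_LIMSEQ_zero) (rule sums_summable)
  have "b < 1"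
  proof (rule ccontr)
    assume "\<not> b < 1"
    obtain k0 where k0: "\<And>k. k \<ge> k0 \<Longrightarrow>
        norm (if k + 1 \<in> A then (real k + 1) * (real k - 1) * b ^ k else 0) < 1"
      using LIMSEQ_D[OF lim, of 1] by auto
    obtain m where m: "m \<in> A" "m \<ge> k0 + 3"
      using False unfolding infinite_nat_iff_unbounded_le by blast
    have "1 * 1 * 1 \<le> (real (m - 1) + 1) * (real (m - 1) - 1) * b ^ (m - 1)"
      using m(2) \<open>\<not> b < 1\<close> by (intro mult_mono one_le_power) auto
    moreover have "k0 \<le> m - 1" "m - 1 + 1 = m" using m(2) by linarith+
    ultimately show False using k0[of "m - 1"] m(1) by (simp only: if_True) simp
  qed
  have "norm (sqrt b) < 1" using b \<open>b < 1\<close> by simp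
  then have "summable (\<lambda>k. of_nat (Suc k) * sqrt b ^ k)"
    using geometric_deriv_sums sums_summable by blast
  then have "summable (\<lambda>k. (offspring_fps A $ k) * sqrt b ^ k)"
    by (rule summable_comparison_test'[where N = 0]) (use b in \<open>simp add: offspring_fps_def\<close>)
  moreover have "b * (1 / sqrt b) = sqrt b" using b by (simp add: field_simps)
  moreover have "1 / sqrt b > 1" using b \<open>b < 1\<close> by simp
  ultimately show ?thesis using that[of "1 / sqrt b"] by simp
qed

theorem theorem5:
  fixes A :: "nat set" and b :: real
  assumes "A \<subseteq> {1..}" and "A \<noteq> {}" and "1 \<in> A" and "A \<noteq> {1, 2}"
    and "b > 0"
    and "((\<lambda>k. (real k + 1) * (real k - 1) * b ^ k) has_sum 0) {k. k + 1 \<in> A}"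
  shows "infinite {n. NC n A \<noteq> {}} \<and>
    (\<lambda>n. real (card (NC n A)))
      \<sim>[inf sequentially (principal {n. NC n A \<noteq> {}})]
    (\<lambda>n. K_const A b * growth_const A b ^ (n - 1) * real n powr (-3/2))"
proof -
  note A_pos = assms(1) and one_A = assms(3) and b = assms(5)
  define w where "w k = offspring_fps A $ k" for k
  have w: "w k = (if Suc k \<in> A then real (Suc k) else 0)" for k by (simp add: w_def offspring_fps_def)
  have w_nonneg: "w k \<ge> 0" for k by (simp add: w)
  define d where "d = Gcd ((\<lambda>a. a - 1) ` A)"
  have sums_ind: "(\<lambda>k. if k + 1 \<in> A then (real k + 1) * (real k - 1) * b ^ k else 0) sums 0"
    using has_sum_imp_sums_indicator[OF assms(6)] by simp
  then have sums_0: "(\<lambda>k. w k * (real k - 1) * b ^ k) sums 0"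
    by (rule sums_cong[THEN iffD1, rotated]) (simp add: w)
  obtain \<rho> where \<rho>: "\<rho> > 1" and sum_\<rho>: "summable (\<lambda>k. w k * (b * \<rho>) ^ k)"
    using ex_larger_radius[OF b sums_ind] unfolding w_def by blast
  obtain k1 where k1: "k1 \<ge> 2" "Suc k1 \<in> A"
  proof -
    \<comment> \<open>Otherwise only the term -1 at \<open>k = 0\<close> would remain, since the
      term at \<open>k = 1\<close> is zero, and the sum could not vanish.\<close>
    have "\<exists>k\<ge>2. w k \<noteq> 0"
    proof (rule ccontr)
      assume "\<not> ?thesis"
      then have "w k * (real k - 1) * b ^ k = (if k = 0 then - 1 else 0)" for k
        using one_A by (cases "k \<ge> 2"; cases "k = 0"; cases "k = 1") (auto simp: w)
      then have "(\<lambda>k. if k = 0 then - 1 else 0 :: real) sums 0" using sums_0 by simp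
      moreover have "(\<lambda>k. if k = 0 then - 1 else 0 :: real) sums (- 1)" by (rule sums_single)
      ultimately show False using sums_unique2 by fastforce
    qed
    then show ?thesis using that by (auto simp: w split: if_splits)
  qed
  have d: "d > 0"
  proof -
    have "k1 \<in> (\<lambda>a. a - 1) ` A" using k1(2) by (force intro: rev_image_eqI)
    then have "d dvd k1" unfolding d_def by (rule Gcd_dvd)
    then show ?thesis using k1(1) by (auto intro!: Nat.gr0I)
  qed
  have w_dvd: "d dvd k" if "w k \<noteq> 0" for k
    using gcd_offspring_dvd[of A 1 k] that by (simp add: w_def d_def)
  have moment: "summable (\<lambda>k. \<bar>w k * real k ^ p * b ^ k\<bar>)" for p
  proof -
    have "(\<lambda>k. real k ^ p / \<rho> ^ k) \<longlonglongrightarrow> 0" using \<rho> by real_asymp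
    then have "\<forall>\<^sub>F k in sequentially. real k ^ p / \<rho> ^ k < 1" by (rule order_tendstoD) simp
    then have "\<forall>\<^sub>F k in sequentially. norm \<bar>w k * real k ^ p * b ^ k\<bar> \<le> w k * (b * \<rho>) ^ k"
    proof eventually_elim
      case (elim k)
      then have "real k ^ p \<le> \<rho> ^ k" using \<rho> by (simp add: divide_less_eq)
      then have "(w k * b ^ k) * real k ^ p \<le> (w k * b ^ k) * \<rho> ^ k"
        using w_nonneg b by (intro mult_left_mono) auto
      then show ?case using w_nonneg[of k] b by (simp add: abs_mult power_mult_distrib mult_ac)
    qed
    then show ?thesis by (rule summable_comparison_test_ev[OF _ sum_\<rho>])
  qed
  have moment': "summable (\<lambda>k. w k * real k ^ p * b ^ k)" for p
    by (rule summable_rabs_cancel[OF moment])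
  define \<Phi> where "\<Phi> = (\<Sum>k. w k * b ^ k)"
  have sums_\<Phi>: "(\<lambda>k. w k * b ^ k) sums \<Phi>"
    using moment'[of 0] by (simp add: \<Phi>_def summable_sums)
  have \<Phi>: "\<Phi> > 0"
    unfolding \<Phi>_def
    by (rule suminf_pos2[of _ 0]) (use sums_\<Phi> w_nonneg b one_A in \<open>auto simp: sums_iff w\<close>)
  have sums_1: "(\<lambda>k. w k * real k * b ^ k) sums \<Phi>"
    using sums_add[OF sums_0 sums_\<Phi>] by (simp add: algebra_simps)
  define V where "V = (\<Sum>k. w k * ((real k)\<^sup>2 - 1) * b ^ k)"
  have sums_V: "(\<lambda>k. w k * ((real k)\<^sup>2 - 1) * b ^ k) sums V"
  proof -
    have "summable (\<lambda>k. w k * ((real k)\<^sup>2 - 1) * b ^ k)"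
      using summable_diff[OF moment'[of 2] moment'[of 0]] by (simp add: algebra_simps)
    then show ?thesis unfolding V_def by (rule summable_sums)
  qed
  \<comment> \<open>\<open>(k - 1)\<^sup>2 = (k\<^sup>2 - 1) - 2 * (k - 1)\<close>, and the last
    part sums to 0. So the sum \<open>V\<close> in the theorem's constant is \<open>\<Phi>\<close>
    times the variance of the critical law.\<close>
  have sums_2: "(\<lambda>k. w k * (real k - 1)\<^sup>2 * b ^ k) sums V"
    using sums_diff[OF sums_V sums_mult[OF sums_0, of 2]]
    by (simp add: algebra_simps power2_eq_square)
  \<comment> \<open>The critical law of the number of children, read on the quotients by
    \<open>d\<close>.\<close>
  define a where "a j = w (d * j) * b ^ (d * j) / \<Phi>" for j
  have d_mono: "strict_mono (\<lambda>j. d * j)" using d by (simp add: strict_mono_def)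
  have off_range: "w k = 0" if "k \<notin> range (\<lambda>j. d * j)" for k
    using w_dvd[of k] that by (auto elim!: dvdE)
  have compress: "(\<lambda>j. a j * g (d * j)) sums (s / \<Phi>)" if "(\<lambda>k. w k * g k * b ^ k) sums s" for g s
  proof -
    have "(\<lambda>j. w (d * j) * g (d * j) * b ^ (d * j)) sums s"
      using sums_mono_reindex[OF d_mono, of "\<lambda>k. w k * g k * b ^ k"] that off_range by simp
    from sums_divide[OF this, of \<Phi>] show ?thesis by (simp add: a_def mult_ac)
  qed
  interpret lattice_law a "\<rho> ^ d"
  proof
    show "a j \<ge> 0" for j using w_nonneg b \<Phi> by (simp add: a_def)
    show "a sums 1" using compress[of "\<lambda>_. 1" \<Phi>] sums_\<Phi> \<Phi> by simp
    show "a 0 > 0" using one_A \<Phi> by (simp add: a_def w)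
    show "\<rho> ^ d > 1" using \<rho> d by (simp add: one_less_power)
    have "(\<lambda>k. w k * \<rho> ^ k * b ^ k) sums (\<Sum>k. w k * (b * \<rho>) ^ k)"
      using summable_sums[OF sum_\<rho>] by (simp add: power_mult_distrib mult_ac)
    from compress[OF this] show "summable (\<lambda>j. a j * (\<rho> ^ d) ^ j)"
      by (simp add: sums_iff power_mult)
    have "(\<lambda>a. a - 1) ` A = (*) d ` {j. a j \<noteq> 0}"
    proof (intro set_eqI iffI)
      fix k assume "k \<in> (\<lambda>a. a - 1) ` A"
      then have "Suc k \<in> A" using A_pos by force
      then have "w k \<noteq> 0" by (simp add: w)
      moreover from w_dvd[OF this] obtain j where "k = d * j" by (rule dvdE)
      ultimately have "k = d * j" "a j \<noteq> 0" using b \<Phi> by (simp_all add: a_def)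
      then show "k \<in> (*) d ` {j. a j \<noteq> 0}" by blast
    next
      fix k assume "k \<in> (*) d ` {j. a j \<noteq> 0}"
      then have "w k \<noteq> 0" by (auto simp: a_def)
      then have "Suc k \<in> A" by (simp add: w split: if_splits)
      then show "k \<in> (\<lambda>a. a - 1) ` A" by (rule rev_image_eqI) simp
    qed
    then have "Gcd ((\<lambda>a. a - 1) ` A) = d * Gcd {j. a j \<noteq> 0}"
      by (simp add: Gcd_mult del: One_nat_def)
    then have "d = d * Gcd {j. a j \<noteq> 0}" unfolding d_def[symmetric] .
    then show "Gcd {j. a j \<noteq> 0} = 1" using d by simp
  qed
  \<comment> \<open>Passing to quotients divides the mean 1 by \<open>d\<close> and the variance
    \<open>V / \<Phi>\<close> by the square of \<open>d\<close>; the latter produces the factor gcd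
    in \<open>K_const\<close>.\<close>
  have mean: "mean = 1 / d"
  proof -
    have "(\<lambda>j. a j * real j) sums (1 / d)"
      using sums_divide[OF compress[OF sums_1], of d] \<Phi> d by simp
    then show ?thesis using sums_mean sums_unique2 by blast
  qed
  have var: "var = V / (d\<^sup>2 * \<Phi>)"
  proof -
    have "(real (d * j) - 1)\<^sup>2 / (real d)\<^sup>2 = (real j - mean)\<^sup>2" for j
      using d by (simp add: mean field_simps flip: power_divide)
    then have "(\<lambda>j. a j * (real j - mean)\<^sup>2) sums (V / \<Phi> / (real d)\<^sup>2)"
      using sums_divide[OF compress[OF sums_2], of "(real d)\<^sup>2"] by (simp flip: times_divide_eq_right)
    then show ?thesis using sums_var sums_unique2 by (fastforce simp: mult.commute)
  qed
  have V: "V > 0" using var_pos \<Phi> d by (simp add: var zero_less_divide_iff mult_less_0_iff)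
  \<comment> \<open>The only candidate sizes: the number of trees of size \<open>n\<close> comes
    from the coefficient of index \<open>n - 2\<close>, which vanishes unless \<open>d\<close>
    divides \<open>n - 2\<close>.\<close>
  define N where "N k = d * k + 2" for k
  define L where "L = 1 / sqrt (2 * pi * var)"
  have L: "L > 0" using var_pos by (simp add: L_def)
  have L_eq: "L = d * sqrt (\<Phi> / (2 * pi * V))"
  proof -
    have "L = sqrt ((real d)\<^sup>2 * (\<Phi> / (2 * pi * V)))"
      using V \<Phi> d by (simp add: L_def var real_sqrt_divide real_sqrt_mult)
    also have "\<dots> = sqrt ((real d)\<^sup>2) * sqrt (\<Phi> / (2 * pi * V))" by (rule real_sqrt_mult)
    finally show ?thesis by simp
  qed
  have N_top: "filterlim N at_top sequentially"
    unfolding N_def using d by (intro filterlim_subseq) (simp add: strict_mono_def)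
  have lim: "(\<lambda>k. sqrt (N k) * fps_nth (Abs_fps a ^ N k) k) \<longlonglongrightarrow> L"
    unfolding L_def
  \<comment> \<open>The sum of \<open>N k\<close> copies has mean
    \<open>N k / d = k + 2 / d\<close>, while the coefficient is taken at \<open>k\<close>.\<close>
  proof (rule local_limit[OF N_top, where d = "- 2 / d"])
    show "real k = real (N k) * mean + - 2 / real d" for k
      using d by (simp add: mean N_def field_simps)
  qed
  have card_eq: "real (card (NC (N k) A)) =
      \<Phi> ^ N k / b ^ (d * k) * fps_nth (Abs_fps a ^ N k) k / (N k - 1)" for k
  proof -
    have "(offspring_fps A ^ N k) $ (d * k) * b ^ (d * k) =
        (Abs_fps (\<lambda>j. offspring_fps A $ (d * j) * b ^ (d * j)) ^ N k) $ k"
      by (rule fps_power_nth_compress[OF d]) (use w_dvd in \<open>simp add: w_def\<close>)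
    moreover have "Abs_fps (\<lambda>j. offspring_fps A $ (d * j) * b ^ (d * j) / \<Phi>) = Abs_fps a"
      by (simp add: a_def w_def fps_eq_iff)
    ultimately have 1: "(offspring_fps A ^ N k) $ (d * k) * b ^ (d * k) = \<Phi> ^ N k * (Abs_fps a ^ N k) $ k"
      using fps_power_cmult_nth[of "\<lambda>j. offspring_fps A $ (d * j) * b ^ (d * j)" \<Phi> "N k" k] \<Phi> by simp
    have 2: "(N k - 1) * real (card (NC (N k) A)) = (offspring_fps A ^ N k) $ (d * k)"
      using card_NC_eq[OF one_A, of "d * k"] by (simp add: N_def)
    have 3: "real (N k - 1) > 0" unfolding of_nat_0_less_iff by (simp add: N_def)
    have "x = P / B * q / c" if "F * B = P * q" "c * x = F" "c > 0" "B > 0" for x P B q c F :: real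
      using that by (auto simp: field_simps)
    from this[OF 1 2 3] show ?thesis using b by simp
  qed
  have growth: "growth_const A b = \<Phi> / b"
  proof -
    have "growth_const A b = (\<Sum>\<^sub>\<infinity>k\<in>{k. k + 1 \<in> A}. (real k + 1) * b ^ k / b)"
      unfolding growth_const_def using b
      by (intro infsum_cong) (simp add: power_int_diff)
    also have "\<dots> = (\<Sum>k. w k * b ^ k / b)"
    proof (subst infsum_eq_suminf)
      have *: "(if k \<in> {k. k + 1 \<in> A} then (real k + 1) * b ^ k / b else 0) = w k * b ^ k / b" for k
        by (simp add: w)
      show "summable (\<lambda>k. \<bar>if k \<in> {k. k + 1 \<in> A} then (real k + 1) * b ^ k / b else 0\<bar>)"
        unfolding * using summable_divide[OF moment[of 0], of b] b by (simp add: abs_mult)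
      show "(\<Sum>k. if k \<in> {k. k + 1 \<in> A} then (real k + 1) * b ^ k / b else 0) = (\<Sum>k. w k * b ^ k / b)"
        unfolding * ..
    qed
    also have "\<dots> = \<Phi> / b" using sums_divide[OF sums_\<Phi>, of b] by (simp add: sums_iff)
    finally show ?thesis .
  qed
  have inf_\<Phi>: "(\<Sum>\<^sub>\<infinity>k | k + 1 \<in> A. (real k + 1) * b ^ k) = \<Phi>"
  proof (subst infsum_eq_suminf)
    have *: "(if k \<in> {k. k + 1 \<in> A} then (real k + 1) * b ^ k else 0) = w k * b ^ k" for k
      by (simp add: w)
    show "summable (\<lambda>k. \<bar>if k \<in> {k. k + 1 \<in> A} then (real k + 1) * b ^ k else 0\<bar>)"
      unfolding * using moment[of 0] by simp
    show "(\<Sum>k. if k \<in> {k. k + 1 \<in> A} then (real k + 1) * b ^ k else 0) = \<Phi>"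
      unfolding * \<Phi>_def ..
  qed
  have inf_V: "(\<Sum>\<^sub>\<infinity>k | k + 1 \<in> A. (real k + 1) * ((real k)\<^sup>2 - 1) * b ^ k) = V"
  proof (subst infsum_eq_suminf)
    have *: "(if k \<in> {k. k + 1 \<in> A} then (real k + 1) * ((real k)\<^sup>2 - 1) * b ^ k else 0) =
        w k * ((real k)\<^sup>2 - 1) * b ^ k" for k
      by (simp add: w)
    have le: "\<bar>w k * ((real k)\<^sup>2 - 1) * b ^ k\<bar> \<le> \<bar>w k * real k ^ 2 * b ^ k\<bar> + \<bar>w k * real k ^ 0 * b ^ k\<bar>" for k
      using abs_triangle_ineq4[of "w k * real k ^ 2 * b ^ k" "w k * real k ^ 0 * b ^ k"]
      by (simp add: algebra_simps)
    show "summable (\<lambda>k. \<bar>if k \<in> {k. k + 1 \<in> A} then (real k + 1) * ((real k)\<^sup>2 - 1) * b ^ k else 0\<bar>)"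
      unfolding *
      by (rule summable_comparison_test'[OF summable_add[OF moment[of 2] moment[of 0]], of 0])
        (use le in simp)
    show "(\<Sum>k. if k \<in> {k. k + 1 \<in> A} then (real k + 1) * ((real k)\<^sup>2 - 1) * b ^ k else 0) = V"
      unfolding * V_def ..
  qed
  have inf_A: "(\<Sum>\<^sub>\<infinity>k\<in>A. real k * b ^ k) = b * \<Phi>"
  proof -
    have "bij_betw Suc {k. k + 1 \<in> A} A"
      by (rule bij_betw_byWitness[where f' = "\<lambda>k. k - 1"]) (use A_pos in force)+
    then have "(\<Sum>\<^sub>\<infinity>k\<in>A. real k * b ^ k) = (\<Sum>\<^sub>\<infinity>k | k + 1 \<in> A. real (Suc k) * b ^ Suc k)"
      by (rule infsum_reindex_bij_betw[symmetric])
    also have "\<dots> = (\<Sum>\<^sub>\<infinity>k | k + 1 \<in> A. b * ((real k + 1) * b ^ k))"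
      by (intro infsum_cong) (simp add: algebra_simps)
    also have "\<dots> = b * \<Phi>" by (simp only: infsum_cmult_right' inf_\<Phi>)
    finally show ?thesis .
  qed
  \<comment> \<open>The factor \<open>b * \<Phi>\<close> turns \<open>(\<Phi> / b) ^ (n - 1)\<close>
    into \<open>\<Phi> ^ n / b ^ (n - 2)\<close>, the normalisation occurring in
    \<open>card_eq\<close>.\<close>
  have K: "K_const A b = L * (b * \<Phi>)"
    unfolding K_const_def inf_\<Phi> inf_V inf_A L_eq d_def ..
  define R where "R n = K_const A b * growth_const A b ^ (n - 1) * real n powr (-3/2)" for n
  \<comment> \<open>The count carries \<open>1 / (n - 1)\<close> and the local limit
    \<open>1 / sqrt n\<close>. Against \<open>n powr (-3/2)\<close> this leaves the factor
    \<open>n / (n - 1)\<close>, which tends to 1.\<close>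
  have ratio: "real (card (NC (N k) A)) / R (N k) =
      (sqrt (N k) * fps_nth (Abs_fps a ^ N k) k / L) * (N k / (N k - 1))" for k
  proof -
    have N0: "real (N k) > 0" unfolding of_nat_0_less_iff by (simp add: N_def)
    have "real (N k) powr (-3/2) = 1 / (N k * sqrt (N k))"
    proof -
      have "real (N k) powr (-3/2) = real (N k) powr (- 1 + - (1/2))" by simp
      also have "\<dots> = real (N k) powr (- 1) * real (N k) powr (- (1/2))" by (rule powr_add)
      also have "real (N k) powr (- 1) = 1 / N k"
        unfolding powr_minus_divide using N0 by simp
      also have "real (N k) powr (- (1/2)) = 1 / sqrt (N k)"
        unfolding powr_minus_divide using N0 by (simp add: powr_half_sqrt)
      also have "1 / N k * (1 / sqrt (N k)) = 1 / (N k * sqrt (N k))" by simp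
      finally show ?thesis .
    qed
    moreover have "b * \<Phi> * (\<Phi> / b) ^ (N k - 1) = \<Phi> ^ N k / b ^ (d * k)"
      using b by (simp add: N_def power_divide)
    ultimately have "R (N k) = L * (\<Phi> ^ N k / b ^ (d * k)) / (N k * sqrt (N k))"
      by (simp add: R_def K growth mult.assoc)
    moreover have "(P * q / c) / (L * P / (x * y)) = (y * q / L) * (x / c)" if "P > 0" for P q c x y :: real
      using that L by (simp add: mult_ac)
    ultimately show ?thesis using card_eq[of k] b \<Phi> by simp
  qed
  have ratio_lim: "(\<lambda>k. real (card (NC (N k) A)) / R (N k)) \<longlonglongrightarrow> 1"
  proof -
    have "(\<lambda>n. real n / real (n - 1)) \<longlonglongrightarrow> 1" by real_asymp
    from filterlim_compose[OF this N_top] have "(\<lambda>k. real (N k) / real (N k - 1)) \<longlonglongrightarrow> 1" .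
    from tendsto_mult[OF tendsto_divide[OF lim tendsto_const[of L]] this]
    show ?thesis unfolding ratio using L by simp
  qed
  \<comment> \<open>Size 1 does not occur because the degree of a single vertex is 0, which is not
    in \<open>A\<close>; from size 2 on, \<open>gcd_offspring_dvd\<close> applies.\<close>
  have mem_N: "n = N ((n - 2) div d)" if "NC n A \<noteq> {}" for n
  proof -
    have card: "real (card (NC n A)) \<noteq> 0" using that finite_NC by simp
    consider "n = 0" | "n = 1" | m where "n = Suc (Suc m)" by (metis One_nat_def not0_implies_Suc)
    then show ?thesis
    proof cases
      case 1
      then show ?thesis using that by (simp add: NC_def noncrossing_tree_def)
    next
      case 2
      have "0 \<notin> A" using A_pos by auto
      then show ?thesis using 2 card card_NC_eq_nth[of 0 A] by (simp add: root_fps_def)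
    next
      case 3
      then have "(offspring_fps A ^ n) $ m \<noteq> 0"
        using card_NC_eq[OF one_A, of m] card by auto
      then have "d dvd m" unfolding d_def by (rule gcd_offspring_dvd)
      then show ?thesis using 3 by (simp add: N_def)
    qed
  qed
  \<comment> \<open>A positive ratio means that trees of size \<open>N k\<close> exist, so all large
    \<open>N k\<close> occur.\<close>
  have "\<forall>\<^sub>F k in sequentially. real (card (NC (N k) A)) / R (N k) > 0"
    using ratio_lim by (rule order_tendstoD) simp
  then obtain k0 where "\<And>k. k \<ge> k0 \<Longrightarrow> real (card (NC (N k) A)) / R (N k) > 0"
    unfolding eventually_sequentially by blast
  then have "N ` {k0..} \<subseteq> {n. NC n A \<noteq> {}}" by fastforce
  moreover have "infinite (N ` {k0..})"
    using d by (subst finite_image_iff) (auto simp: inj_on_def N_def infinite_Ici)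
  ultimately have inf: "infinite {n. NC n A \<noteq> {}}" using infinite_super by blast
  \<comment> \<open>The limit along \<open>k\<close> is reparametrised by \<open>n\<close>; by
    \<open>mem_N\<close>, \<open>N ((n - 2) div d)\<close> is \<open>n\<close> itself on the sizes
    that occur.\<close>
  have "filterlim (\<lambda>n. (n - 2) div d) at_top sequentially"
  proof (rule filterlim_at_top_mono[where f = "\<lambda>n. n div d - 2"])
    show "filterlim (\<lambda>n. n div d - 2) at_top sequentially"
      unfolding filterlim_at_top
    proof
      fix Z
      show "\<forall>\<^sub>F n in sequentially. Z \<le> n div d - 2"
      proof (rule eventually_sequentiallyI)
        fix n assume "n \<ge> d * (Z + 2)"
        then have "Z + 2 \<le> n div d" using d by (simp add: less_eq_div_iff_mult_less_eq mult.commute)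
        then show "Z \<le> n div d - 2" by simp
      qed
    qed
    show "\<forall>\<^sub>F n in sequentially. n div d - 2 \<le> (n - 2) div d"
    proof (rule always_eventually, rule allI)
      fix n
      have "n div d \<le> ((n - 2) + d * 2) div d" using d by (intro div_le_mono) simp
      also have "\<dots> = (n - 2) div d + 2" using d by simp
      finally show "n div d - 2 \<le> (n - 2) div d" by simp
    qed
  qed
  from filterlim_compose[OF ratio_lim this]
  have "((\<lambda>n. real (card (NC (N ((n - 2) div d)) A)) / R (N ((n - 2) div d))) \<longlongrightarrow> 1)
      (inf sequentially (principal {n. NC n A \<noteq> {}}))"
    by (rule tendsto_mono[rotated]) simp
  moreover have "\<forall>\<^sub>F n in inf sequentially (principal {n. NC n A \<noteq> {}}).
      real (card (NC (N ((n - 2) div d)) A)) / R (N ((n - 2) div d)) = real (card (NC n A)) / R n"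
    unfolding eventually_inf_principal using mem_N by (intro always_eventually) auto
  ultimately have "((\<lambda>n. real (card (NC n A)) / R n) \<longlongrightarrow> 1) (inf sequentially (principal {n. NC n A \<noteq> {}}))"
    by (rule Lim_transform_eventually)
  then have "(\<lambda>n. real (card (NC n A))) \<sim>[inf sequentially (principal {n. NC n A \<noteq> {}})] R"
    by (rule asymp_equivI')
  with inf show ?thesis by (simp add: R_def[abs_def])
qed

end
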